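(* Let $\Delta \colon \mathbb{N} \to [0,\infty)$ be an order function such that $\lim_{n \to \infty}\Delta(n)/\sqrt{n} = 0$ and let $\epsilon \in (0,1)$ be rational. Then $$\mathrm{COMPLEX}\bigl(\lambda n.\, n-\sqrt{n}\cdot \Delta(n)\bigr) \leq_{\mathrm{w}} \mathrm{LUA}\bigl(\lambda n.\, 2^{(1-\epsilon)\Delta(\log_2\log_2 n)}\bigr).$$ More generally, $\mathrm{COMPLEX}(\lambda n.\, n - \sqrt{n}\cdot \Delta(n)) \leq_{\mathrm{w}} \mathrm{LUA}(q)$ for any order function $q$ satisfying $$q\Bigl( \exp_2\bigl((1-\epsilon)^{-1} \cdot [(n+1)^2 - (n+1) \cdot \Delta((n+1)^2)] \cdot \ell(n)\bigr) \Bigr) \leq \ell(n)$$ for almost all $n \in \mathbb{N}$, where $\ell(n) = \exp_2\left((1-\epsilon)[(n+1) \cdot \Delta((n+1)^2) - n \cdot \Delta(n^2)]\right)$.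
   Context: $\exp_2(x)=2^x$; "almost all" means all but finitely many. An order function is a computable (i.e. its values are uniformly computable reals), nondecreasing, unbounded function $\mathbb{N}\to\mathbb{R}$. An order function evaluated at a nonnegative real argument is understood via its piecewise linear extension, $f(x)=(f(\lfloor x\rfloor+1)-f(\lfloor x\rfloor))(x-\lfloor x\rfloor)+f(\lfloor x\rfloor)$. Prefix-free complexity: a prefix-free machine is a partial recursive $M$ from $\{0,1\}^*$ to $\{0,1\}^*$ with prefix-free domain; $U$ is universal if for each prefix-free machine $M$ there is $\rho$ with $U(\rho^\frown\tau)\simeq M(\tau)$ for all $\tau$. Fix a universal $U$ and let $K(\sigma)=\min\{|\tau| : U(\tau)=\sigma\}$. For $f\colon\mathbb{N}\to\mathbb{R}$, $\mathrm{COMPLEX}(f)$ is the set of $X\in\{0,1\}^{\mathbb{N}}$ for which there is $c\in\mathbb{N}$ with $K(X\upharpoonright n)\geq f(n)-c$ for all $n$. A partial recursive $\psi\colon\subseteq\mathbb{N}\to\mathbb{N}$ is linearly universal if for every partial recursive $\theta\colon\subseteq\mathbb{N}\to\mathbb{N}$ there are $a,b\in\mathbb{N}$ with $\psi(ax+b)\simeq\theta(x)$ for all $x$. For $p\colon\mathbb{N}\to(1,\infty)$, $\mathrm{LUA}(p)$ is the set of $X\in\mathbb{N}^{\mathbb{N}}$ such that $X(n)<p(n)$ for all $n$ and, for some linearly universal partial recursive $\psi$, there is no $n\in\operatorname{dom}\psi$ with $X(n)=\psi(n)$. Convention: if $p$ is only a partial function into $\mathbb{R}$, but its restriction to $\{n\ge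 a\}$ is total, computable, nondecreasing, unbounded with values in $(1,\infty)$ for some $a$, then $\mathrm{LUA}(p)$ means $\mathrm{LUA}(\tilde p)$ where $\tilde p(n)=p(n)$ for $n\geq a$ and $\tilde p(n)=p(a)$ for $n<a$ (different $a$ give weakly equivalent classes). For $P,Q\subseteq\mathbb{N}^{\mathbb{N}}$, $P\leq_{\mathrm{w}}Q$ (weak/Muchnik reducibility) means every $Y\in Q$ Turing-computes some $X\in P$. *)

theory Defs
  imports Complex_Main "HOL-Library.Sublist"
begin

section \<open>Partial recursive functions and relative computability\<close>

datatype recf =
    Zero
  | Succ
  | Proj nat
  | Query
  | Comp recf "recf list"
  | PrimRec recf recf
  | Mu recf

text \<open>
  \<open>eval A e xs y\<close>: the program \<open>e\<close> with oracle \<open>A\<close> halts on input \<open>xs\<close> with output \<open>y\<close>.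
  The oracle is a partial function, so that \<open>Map.empty\<close> (every query diverges) gives computation
  without an oracle.
\<close>

inductive eval :: "(nat \<rightharpoonup> nat) \<Rightarrow> recf \<Rightarrow> nat list \<Rightarrow> nat \<Rightarrow> bool" for A where
  Zero: "eval A Zero xs 0"
| Succ: "eval A Succ [x] (Suc x)"
| Proj: "i < length xs \<Longrightarrow> eval A (Proj i) xs (xs ! i)"
| Query: "A x = Some y \<Longrightarrow> eval A Query [x] y"
| Comp: "list_all2 (\<lambda>g y. eval A g xs y) gs ys \<Longrightarrow> eval A f ys z \<Longrightarrow> eval A (Comp f gs) xs z"
| PrimRec_0: "eval A f xs z \<Longrightarrow> eval A (PrimRec f g) (0 # xs) z"
| PrimRec_Suc: "eval A (PrimRec f g) (n # xs) y \<Longrightarrow> eval A g (n # y # xs) z \<Longrightarrow>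
    eval A (PrimRec f g) (Suc n # xs) z"
| Mu: "eval A f (n # xs) 0 \<Longrightarrow> (\<forall>m<n. \<exists>y. eval A f (m # xs) (Suc y)) \<Longrightarrow> eval A (Mu f) xs n"

definition partial_recursive :: "(nat \<rightharpoonup> nat) \<Rightarrow> bool" where
  "partial_recursive f \<longleftrightarrow> (\<exists>e. \<forall>x y. eval Map.empty e [x] y \<longleftrightarrow> f x = Some y)"

definition recursive2 :: "(nat \<Rightarrow> nat \<Rightarrow> nat) \<Rightarrow> bool" where
  "recursive2 g \<longleftrightarrow> (\<exists>e. \<forall>x y z. eval Map.empty e [x, y] z \<longleftrightarrow> g x y = z)"

definition turing_computes :: "(nat \<Rightarrow> nat) \<Rightarrow> (nat \<Rightarrow> nat) \<Rightarrow> bool" where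
  "turing_computes Y X \<longleftrightarrow> (\<exists>e. \<forall>n y. eval (\<lambda>x. Some (Y x)) e [n] y \<longleftrightarrow> X n = y)"

definition weakly_reducible :: "(nat \<Rightarrow> nat) set \<Rightarrow> (nat \<Rightarrow> nat) set \<Rightarrow> bool"
    (infix "\<le>\<^sub>w" 50) where
  "P \<le>\<^sub>w Q \<longleftrightarrow> (\<forall>Y\<in>Q. \<exists>X\<in>P. turing_computes Y X)"


section \<open>Order functions\<close>

text \<open>
  Uniformly computable reals: there is a recursive double sequence of rationals, here
  \<open>(a n k - b n k) / (c n k + 1)\<close>, converging to \<open>f n\<close> at rate \<open>2\<^sup>-\<^sup>k\<close>.
\<close>

definition computable_reals :: "(nat \<Rightarrow> real) \<Rightarrow> bool" where
  "computable_reals f \<longleftrightarrow> (\<exists>a b c. recursive2 a \<and> recursive2 b \<and> recursive2 c \<and>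
     (\<forall>n k. \<bar>f n - (real (a n k) - real (b n k)) / (real (c n k) + 1)\<bar> \<le> 1 / 2 ^ k))"

definition order_function :: "(nat \<Rightarrow> real) \<Rightarrow> bool" where
  "order_function f \<longleftrightarrow> computable_reals f \<and> mono f \<and> \<not> bdd_above (range f)"

text \<open>Piecewise linear extension, meant for arguments \<open>x \<ge> 0\<close>.\<close>

definition plin :: "(nat \<Rightarrow> real) \<Rightarrow> real \<Rightarrow> real" where
  "plin f x = (let m = nat \<lfloor>x\<rfloor> in (f (m + 1) - f m) * (x - real m) + f m)"


section \<open>Prefix-free complexity\<close>

text \<open>Bijective base-2 numeration, a bijection between binary strings and natural numbers.\<close>

fun str_code :: "bool list \<Rightarrow> nat" where
  "str_code [] = 0"
| "str_code (b # \<sigma>) = 2 * str_code \<sigma> + (if b then 2 else 1)"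

definition prefix_free_machine :: "(bool list \<rightharpoonup> bool list) \<Rightarrow> bool" where
  "prefix_free_machine M \<longleftrightarrow>
     (\<exists>f. partial_recursive f \<and> (\<forall>\<sigma>. f (str_code \<sigma>) = map_option str_code (M \<sigma>))) \<and>
     (\<forall>\<sigma>\<in>dom M. \<forall>\<tau>\<in>dom M. prefix \<sigma> \<tau> \<longrightarrow> \<sigma> = \<tau>)"

definition universal_machine :: "(bool list \<rightharpoonup> bool list) \<Rightarrow> bool" where
  "universal_machine U \<longleftrightarrow> prefix_free_machine U \<and>
     (\<forall>M. prefix_free_machine M \<longrightarrow> (\<exists>\<rho>. \<forall>\<tau>. U (\<rho> @ \<tau>) = M \<tau>))"

definition KP :: "(bool list \<rightharpoonup> bool list) \<Rightarrow> bool list \<Rightarrow> nat" where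
  "KP U \<sigma> = (LEAST k. \<exists>\<tau>. length \<tau> = k \<and> U \<tau> = Some \<sigma>)"

text \<open>Binary sequences are viewed as \<open>{0,1}\<close>-valued elements of Baire space.\<close>

definition COMPLEX :: "(bool list \<rightharpoonup> bool list) \<Rightarrow> (nat \<Rightarrow> real) \<Rightarrow> (nat \<Rightarrow> nat) set" where
  "COMPLEX U f = {\<lambda>n. of_bool (X n) | X :: nat \<Rightarrow> bool.
     \<exists>c::nat. \<forall>n. real (KP U (map X [0..<n])) \<ge> f n - real c}"


section \<open>Linearly universal avoidance\<close>

definition linearly_universal :: "(nat \<rightharpoonup> nat) \<Rightarrow> bool" where
  "linearly_universal \<psi> \<longleftrightarrow> partial_recursive \<psi> \<and>
     (\<forall>\<theta>. partial_recursive \<theta> \<longrightarrow> (\<exists>a b. \<forall>x. \<psi> (a * x + b) = \<theta> x))"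

definition LUA :: "(nat \<Rightarrow> real) \<Rightarrow> (nat \<Rightarrow> nat) set" where
  "LUA p = {X. (\<forall>n. real (X n) < p n) \<and>
     (\<exists>\<psi>. linearly_universal \<psi> \<and> (\<forall>n. \<psi> n \<noteq> Some (X n)))}"

text \<open>
  For a \<open>p\<close> that is only meaningful, with values in \<open>(1, \<infinity>)\<close>, on \<open>{a..}\<close>:
  the values below \<open>a\<close> are replaced by \<open>p a\<close>.
\<close>

definition LUA_from :: "nat \<Rightarrow> (nat \<Rightarrow> real) \<Rightarrow> (nat \<Rightarrow> nat) set" where
  "LUA_from a p = LUA (\<lambda>n. if a \<le> n then p n else p a)"

definition ell :: "real \<Rightarrow> (nat \<Rightarrow> real) \<Rightarrow> nat \<Rightarrow> real" where
  "ell \<epsilon> \<Delta> n =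
     2 powr ((1 - \<epsilon>) * ((real n + 1) * \<Delta> ((n + 1)\<^sup>2) - real n * \<Delta> (n\<^sup>2)))"

end

theory Submission
  imports Defs "HOL-Library.Discrete_Functions"
begin

text \<open>
  Cut a sequence into blocks so that the first \<open>n\<close> blocks have length \<open>n\<^sup>2\<close>, and call a string of
  length \<open>n\<^sup>2\<close> heavy if the descriptions of its extensions have total weight more than
  \<open>2 ^ (D n - n\<^sup>2)\<close>, where \<open>D (n + 1) - D n\<close> is \<open>log 2 (ell \<epsilon> \<Delta> n)\<close> up to a bounded error. Put
  \<open>N = 2 ^ (2 * n + 1)\<close> and \<open>a = 2 ^ (D (n + 1) - D n)\<close>. A string which is not heavy has \<open>N\<close>
  children, of which at most \<open>N / a\<close> are heavy, and heaviness is recursively enumerable. For an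
  \<open>a\<close>-tuple of children, linear universality turns the question which of them is found heavy first
  into a value of \<open>\<psi>\<close>, and \<open>Y\<close>, whose value there is below \<open>a\<close>, names another one. If all children
  of a set are found heavy after \<open>k\<close> others at the earliest, then the ones named by \<open>Y\<close> in the
  \<open>a\<close>-subsets of this set are found heavy after \<open>k + 1\<close> others at the earliest, and all but \<open>a - 1\<close>
  children in the set are so named. After \<open>N / a\<close> rounds there is still a child left, and it is
  not heavy. In the final estimate the factor \<open>1 - \<epsilon>\<close> absorbs the bounded errors and the lengths
  between two squares.
\<close>

section \<open>Total recursive functions relative to an oracle\<close>

text \<open>Squares make every loss one of lower order: rounding costs boundedly many bits per
  block, hence O(n) at length \<open>n\<^sup>2\<close>, and so does the gap to the next square,
  while the permitted loss is \<open>n * \<Delta> (n\<^sup>2)\<close> with \<Delta> unbounded.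
  Weight counts the descriptions of all extensions of a string, not only its own: it is then shared
  out among the children, which bounds the number of heavy ones, and a node that is not heavy bounds
  the complexity of every longer prefix without logarithmic terms.

  A question at level \<open>n\<close> names a node and about \<open>ell\<close> children, so it has
  about \<open>n\<^sup>2 + n * ell\<close> bits up to constant factors. Linear universality
  translates it by \<open>a * x + b\<close>, which adds only constantly many bits, and the condition
  on \<open>q\<close> bounds \<open>Y\<close> by \<open>ell\<close> at numbers of that size.

  The actual order of discovery is never known. The search for the next child tests candidates
  against all orders compatible with the answers of \<open>Y\<close>, of which there are finitely
  many, and the combinatorics only has to guarantee that some candidate passes. As the bounds on
  \<open>Y\<close> hold from some level on, the path starts at a node hard-wired into the
  program.\<close>

inductive_cases eval_ZeroE: "eval A Zero xs z"
inductive_cases eval_SuccE: "eval A Succ xs z"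
inductive_cases eval_ProjE: "eval A (Proj i) xs z"
inductive_cases eval_QueryE: "eval A Query xs z"
inductive_cases eval_CompE: "eval A (Comp f gs) xs z"
inductive_cases eval_PrimRec_0E: "eval A (PrimRec f g) (0 # xs) z"
inductive_cases eval_PrimRec_SucE: "eval A (PrimRec f g) (Suc n # xs) z"
inductive_cases eval_MuE: "eval A (Mu f) xs z"

lemma eval_determ: "eval A e xs y \<Longrightarrow> eval A e xs z \<Longrightarrow> y = z"
proof (induction arbitrary: z rule: eval.induct)
  case (Zero xs)
  then show ?case by (rule eval_ZeroE) simp
next
  case (Succ x)
  then show ?case by (rule eval_SuccE) simp
next
  case (Proj i xs)
  from Proj.prems show ?case by (rule eval_ProjE) simp
next
  case (Query x y)
  from Query.prems Query.hyps show ?case by (elim eval_QueryE) simp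
next
  case (Comp xs gs ys f w)
  from Comp.prems obtain ys' where
    ys': "list_all2 (\<lambda>g y. eval A g xs y) gs ys'" "eval A f ys' z"
    by (rule eval_CompE)
  have IH: "length gs = length ys"
    "\<And>i u. i < length gs \<Longrightarrow> eval A (gs ! i) xs u \<Longrightarrow> ys ! i = u"
    using Comp.IH(1) by (simp_all add: list_all2_conv_all_nth)
  have ys'': "length gs = length ys'" "\<And>i. i < length gs \<Longrightarrow> eval A (gs ! i) xs (ys' ! i)"
    using ys'(1) by (simp_all add: list_all2_conv_all_nth)
  have "ys = ys'"
  proof (rule nth_equalityI)
    show "length ys = length ys'" using IH(1) ys''(1) by simp
    fix i assume "i < length ys"
    then have "i < length gs" using IH(1) by simp
    then show "ys ! i = ys' ! i" using IH(2) ys''(2) by simp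
  qed
  then show ?case using Comp.IH(2) ys'(2) by simp
next
  case (PrimRec_0 f xs w g)
  from PrimRec_0.prems have "eval A f xs z" by (rule eval_PrimRec_0E)
  then show ?case by (rule PrimRec_0.IH)
next
  case (PrimRec_Suc f g n xs y w)
  from PrimRec_Suc.prems obtain y' where y': "eval A (PrimRec f g) (n # xs) y'" "eval A g (n # y' # xs) z"
    by (rule eval_PrimRec_SucE)
  from PrimRec_Suc.IH(1)[OF y'(1)] y'(2) show ?case by (intro PrimRec_Suc.IH(2)) simp
next
  case (Mu f n xs)
  from Mu.prems have z: "eval A f (z # xs) 0" "\<forall>m<z. \<exists>y. eval A f (m # xs) (Suc y)"
    by (auto elim: eval_MuE)
  have "\<not> z < n"
  proof
    assume "z < n"
    then obtain y where "\<forall>u. eval A f (z # xs) u \<longrightarrow> Suc y = u" using Mu.IH(2) by blast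
    with z(1) have "Suc y = 0" by blast
    then show False by simp
  qed
  moreover have "\<not> n < z"
  proof
    assume "n < z"
    then obtain y where "eval A f (n # xs) (Suc y)" using z(2) by blast
    from Mu.IH(1)[OF this] show False by simp
  qed
  ultimately show ?case by simp
qed

lemma eval_oracle_mono: "eval A e xs y \<Longrightarrow> A \<subseteq>\<^sub>m B \<Longrightarrow> eval B e xs y"
proof (induction rule: eval.induct)
  case (Query x y)
  then show ?case by (auto simp: map_le_def dom_def intro!: eval.Query)
next
  case (Comp xs gs ys f z)
  then show ?case by (auto intro!: eval.Comp elim: list_all2_mono)
qed (auto intro: eval.intros)

text \<open>Only one direction of the graph is demanded; \<open>eval_determ\<close> supplies the
  converse where \<open>turing_computes\<close> asks for it.\<close>

definition recursive_in :: "(nat \<rightharpoonup> nat) \<Rightarrow> nat \<Rightarrow> (nat list \<Rightarrow> nat) \<Rightarrow> bool" where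
  "recursive_in A k f \<longleftrightarrow> (\<exists>e. \<forall>xs. length xs = k \<longrightarrow> eval A e xs (f xs))"

definition decidable_in :: "(nat \<rightharpoonup> nat) \<Rightarrow> nat \<Rightarrow> (nat list \<Rightarrow> bool) \<Rightarrow> bool" where
  "decidable_in A k P \<longleftrightarrow> recursive_in A k (\<lambda>xs. of_bool (P xs))"

lemma recursive_in_oracle:
  "recursive_in Map.empty k f \<Longrightarrow> recursive_in A k f"
  unfolding recursive_in_def using eval_oracle_mono[OF _ map_le_empty] by blast

lemma recursive_in_cong:
  assumes "recursive_in A k f" "\<And>xs. length xs = k \<Longrightarrow> f xs = g xs"
  shows "recursive_in A k g"
  using assms unfolding recursive_in_def by metis

lemma turing_computesI:
  assumes "recursive_in (\<lambda>x. Some (Y x)) 1 (\<lambda>xs. X (xs ! 0))"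
  shows "turing_computes Y X"
proof -
  obtain e where e: "\<And>xs. length xs = 1 \<Longrightarrow> eval (\<lambda>x. Some (Y x)) e xs (X (xs ! 0))"
    using assms unfolding recursive_in_def by auto
  have "eval (\<lambda>x. Some (Y x)) e [n] (X n)" for n using e[of "[n]"] by simp
  then show ?thesis unfolding turing_computes_def using eval_determ by blast
qed

lemma recursive2_recursive_in:
  assumes "recursive2 g"
  shows "recursive_in A 2 (\<lambda>xs. g (xs ! 0) (xs ! 1))"
proof -
  obtain e where e: "\<And>x y z. eval Map.empty e [x, y] z \<longleftrightarrow> g x y = z"
    using assms unfolding recursive2_def by auto
  have *: "eval Map.empty e [x, y] (g x y)" for x y using e by blast
  have "eval Map.empty e xs (g (xs ! 0) (xs ! 1))" if "length xs = 2" for xs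
  proof -
    from that have "xs = [xs ! 0, xs ! 1]"
      by (intro nth_equalityI) (auto simp: less_2_cases_iff)
    then show ?thesis using *[of "xs ! 0" "xs ! 1"] by metis
  qed
  then have "recursive_in Map.empty 2 (\<lambda>xs. g (xs ! 0) (xs ! 1))"
    unfolding recursive_in_def by blast
  then show ?thesis by (rule recursive_in_oracle)
qed

named_theorems rec_intros

lemma recursive_in_nth [rec_intros]: "i < k \<Longrightarrow> recursive_in A k (\<lambda>xs. xs ! i)"
  unfolding recursive_in_def by (metis eval.Proj)

lemma recursive_in_nth_drop: "i + j < k \<Longrightarrow> recursive_in A k (\<lambda>xs. drop j xs ! i)"
  by (rule recursive_in_cong[OF recursive_in_nth[of "i + j"]]) (auto simp: add.commute)

text \<open>Every binder pushes its variable onto the front of the argument list, so the outer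
  arguments reappear behind iterated \<open>tl\<close>. The unfolded \<open>certified\<close> nests
  seven bounded quantifiers.\<close>

lemma recursive_in_nth_tl [rec_intros]:
  "i + 1 < k \<Longrightarrow> recursive_in A k (\<lambda>xs. tl xs ! i)"
  "i + 2 < k \<Longrightarrow> recursive_in A k (\<lambda>xs. tl (tl xs) ! i)"
  "i + 3 < k \<Longrightarrow> recursive_in A k (\<lambda>xs. tl (tl (tl xs)) ! i)"
  "i + 4 < k \<Longrightarrow> recursive_in A k (\<lambda>xs. tl (tl (tl (tl xs))) ! i)"
  "i + 5 < k \<Longrightarrow> recursive_in A k (\<lambda>xs. tl (tl (tl (tl (tl xs)))) ! i)"
  "i + 6 < k \<Longrightarrow> recursive_in A k (\<lambda>xs. tl (tl (tl (tl (tl (tl xs))))) ! i)"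
  "i + 7 < k \<Longrightarrow> recursive_in A k (\<lambda>xs. tl (tl (tl (tl (tl (tl (tl xs)))))) ! i)"
  using recursive_in_nth_drop[of i 1 k A] recursive_in_nth_drop[of i 2 k A]
    recursive_in_nth_drop[of i 3 k A] recursive_in_nth_drop[of i 4 k A]
    recursive_in_nth_drop[of i 5 k A] recursive_in_nth_drop[of i 6 k A]
    recursive_in_nth_drop[of i 7 k A]
  by (simp_all add: drop_Suc numeral_eq_Suc)

lemma recursive_in_compose:
  assumes "recursive_in A (length gs) f" "\<And>g. g \<in> set gs \<Longrightarrow> recursive_in A k g"
  shows "recursive_in A k (\<lambda>xs. f (map (\<lambda>g. g xs) gs))"
proof -
  obtain e where e: "\<And>xs. length xs = length gs \<Longrightarrow> eval A e xs (f xs)"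
    using assms(1) unfolding recursive_in_def by auto
  have "\<forall>g\<in>set gs. \<exists>e. \<forall>xs. length xs = k \<longrightarrow> eval A e xs (g xs)"
    using assms(2) unfolding recursive_in_def by blast
  then obtain h where h: "\<And>g xs. g \<in> set gs \<Longrightarrow> length xs = k \<Longrightarrow> eval A (h g) xs (g xs)"
    by metis
  have "eval A (Comp e (map h gs)) xs (f (map (\<lambda>g. g xs) gs))" if "length xs = k" for xs
    using that by (intro eval.Comp[OF _ e]) (auto simp: list_all2_conv_all_nth intro: h)
  then show ?thesis unfolding recursive_in_def by blast
qed

lemma recursive_in_compose1:
  assumes "recursive_in A 1 (\<lambda>xs. h (xs ! 0))" "recursive_in A k f"
  shows "recursive_in A k (\<lambda>xs. h (f xs))"
  using recursive_in_compose[of A "[f]" "\<lambda>xs. h (xs ! 0)" k] assms by simp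

lemma recursive_in_compose2:
  assumes "recursive_in A 2 (\<lambda>xs. h (xs ! 0) (xs ! 1))" "recursive_in A k f" "recursive_in A k g"
  shows "recursive_in A k (\<lambda>xs. h (f xs) (g xs))"
  using recursive_in_compose[of A "[f, g]" "\<lambda>xs. h (xs ! 0) (xs ! 1)" k] assms
  by (auto simp: numeral_2_eq_2)

lemma recursive_in_compose3:
  assumes "recursive_in A 3 (\<lambda>xs. h (xs ! 0) (xs ! 1) (xs ! 2))"
    "recursive_in A k f1" "recursive_in A k f2" "recursive_in A k f3"
  shows "recursive_in A k (\<lambda>xs. h (f1 xs) (f2 xs) (f3 xs))"
  using recursive_in_compose[of A "[f1, f2, f3]" "\<lambda>xs. h (xs ! 0) (xs ! 1) (xs ! 2)" k] assms
  by (auto simp: numeral_eq_Suc)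

lemma recursive_in_const [rec_intros]: "recursive_in A k (\<lambda>xs. c)"
proof (induction c)
  case 0
  show ?case unfolding recursive_in_def by (metis eval.Zero)
next
  case (Suc c)
  have "recursive_in A 1 (\<lambda>xs. Suc (xs ! 0))"
    unfolding recursive_in_def by (rule exI[of _ Succ]) (auto simp: length_Suc_conv intro: eval.Succ)
  then show ?case using recursive_in_compose1[of A Suc, OF _ Suc.IH] by simp
qed

lemma recursive_in_Suc [rec_intros]:
  "recursive_in A k f \<Longrightarrow> recursive_in A k (\<lambda>xs. Suc (f xs))"
proof (rule recursive_in_compose1[where h = Suc])
  show "recursive_in A 1 (\<lambda>xs. Suc (xs ! 0))"
    unfolding recursive_in_def by (rule exI[of _ Succ]) (auto simp: length_Suc_conv intro: eval.Succ)
qed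

lemma recursive_in_oracle_query:
  assumes "recursive_in (\<lambda>x. Some (Y x)) k f"
  shows "recursive_in (\<lambda>x. Some (Y x)) k (\<lambda>xs. Y (f xs))"
proof (rule recursive_in_compose1[OF _ assms])
  show "recursive_in (\<lambda>x. Some (Y x)) 1 (\<lambda>xs. Y (xs ! 0))"
    unfolding recursive_in_def by (rule exI[of _ Query]) (auto simp: length_Suc_conv intro: eval.Query)
qed

lemma recursive_in_rec_nat_aux:
  assumes "recursive_in A k f" "recursive_in A (Suc (Suc k)) (\<lambda>ys. g (ys ! 0) (ys ! 1) (tl (tl ys)))"
  shows "recursive_in A (Suc k) (\<lambda>ys. rec_nat (f (tl ys)) (\<lambda>i r. g i r (tl ys)) (ys ! 0))"
proof -
  obtain e where e: "\<And>xs. length xs = k \<Longrightarrow> eval A e xs (f xs)"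
    using assms(1) unfolding recursive_in_def by auto
  obtain e' where e': "\<And>ys. length ys = Suc (Suc k) \<Longrightarrow> eval A e' ys (g (ys ! 0) (ys ! 1) (tl (tl ys)))"
    using assms(2) unfolding recursive_in_def by auto
  have *: "eval A (PrimRec e e') (n # xs) (rec_nat (f xs) (\<lambda>i r. g i r xs) n)" if "length xs = k" for xs n
  proof (induction n)
    case 0
    show ?case using e[OF that] by (auto intro: eval.PrimRec_0)
  next
    case (Suc n)
    show ?case using e'[of "n # rec_nat (f xs) (\<lambda>i r. g i r xs) n # xs"] that
      by (auto intro: eval.PrimRec_Suc[OF Suc])
  qed
  have "eval A (PrimRec e e') ys (rec_nat (f (tl ys)) (\<lambda>i r. g i r (tl ys)) (ys ! 0))"
    if "length ys = Suc k" for ys using that * by (cases ys) auto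
  then show ?thesis unfolding recursive_in_def by blast
qed

lemma map_nth_upt_id: "length xs = k \<Longrightarrow> map ((!) xs) [0..<k] = xs"
  by (auto simp: map_nth)

lemma recursive_in_cons:
  assumes "recursive_in A (Suc k) f" "recursive_in A k n"
  shows "recursive_in A k (\<lambda>xs. f (n xs # xs))"
proof -
  have "recursive_in A k (\<lambda>xs. f (map (\<lambda>g. g xs) (n # map (\<lambda>i xs. xs ! i) [0..<k])))"
    by (rule recursive_in_compose) (use assms in \<open>auto intro: recursive_in_nth\<close>)
  then show ?thesis
    by (rule recursive_in_cong) (simp add: comp_def map_nth_upt_id)
qed

lemma recursive_in_rec_nat [rec_intros]:
  assumes "recursive_in A k n" "recursive_in A k f"
    "recursive_in A (Suc (Suc k)) (\<lambda>ys. g (ys ! 0) (ys ! 1) (tl (tl ys)))"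
  shows "recursive_in A k (\<lambda>xs. rec_nat (f xs) (\<lambda>i r. g i r xs) (n xs))"
  using recursive_in_cons[OF recursive_in_rec_nat_aux[OF assms(2,3)] assms(1)] by simp

text \<open>The step of a recursion receives the counter, the accumulated value and the parameters;
  this admits functions there that ignore the accumulated value.\<close>

lemma recursive_in_skip:
  assumes "recursive_in A (Suc k) (\<lambda>ys. f (ys ! 0) (tl ys))"
  shows "recursive_in A (Suc (Suc k)) (\<lambda>ys. f (ys ! 0) (tl (tl ys)))"
proof -
  have "recursive_in A (Suc (Suc k)) (\<lambda>xs. (\<lambda>ys. f (ys ! 0) (tl ys))
     (map (\<lambda>g. g xs) ((\<lambda>xs. xs ! 0) # map (\<lambda>i xs. xs ! Suc (Suc i)) [0..<k])))"
    by (rule recursive_in_compose) (use assms in \<open>auto intro: recursive_in_nth\<close>)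
  then show ?thesis
  proof (rule recursive_in_cong)
    fix xs :: "nat list" assume "length xs = Suc (Suc k)"
    then have "map (\<lambda>i. xs ! Suc (Suc i)) [0..<k] = tl (tl xs)"
      by (intro nth_equalityI) (auto simp: nth_tl)
    then show "f (map (\<lambda>g. g xs) ((\<lambda>xs. xs ! 0) # map (\<lambda>i xs. xs ! Suc (Suc i)) [0..<k]) ! 0)
      (tl (map (\<lambda>g. g xs) ((\<lambda>xs. xs ! 0) # map (\<lambda>i xs. xs ! Suc (Suc i)) [0..<k])))
      = f (xs ! 0) (tl (tl xs))" by (simp add: comp_def)
  qed
qed

section \<open>Closure under arithmetic, bounded quantifiers, sums and search\<close>

lemma recursive_in_add [rec_intros]:
  assumes "recursive_in A k f" "recursive_in A k g"
  shows "recursive_in A k (\<lambda>xs. f xs + g xs)"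
proof -
  have "rec_nat a (\<lambda>i r. Suc r) b = a + b" for a b :: nat by (induction b) auto
  moreover have "recursive_in A k (\<lambda>xs. rec_nat (f xs) (\<lambda>i r. Suc r) (g xs))"
    by (intro rec_intros assms) auto
  ultimately show ?thesis by simp
qed

lemma recursive_in_mult [rec_intros]:
  assumes "recursive_in A k f" "recursive_in A k g"
  shows "recursive_in A k (\<lambda>xs. f xs * g xs)"
proof (rule recursive_in_compose2[OF _ assms])
  have "rec_nat 0 (\<lambda>i r. r + a) b = a * b" for a b :: nat by (induction b) auto
  moreover have "recursive_in A 2 (\<lambda>xs. rec_nat 0 (\<lambda>i r. r + xs ! 0) (xs ! 1))"
    by (intro rec_intros) auto
  ultimately show "recursive_in A 2 (\<lambda>xs. xs ! 0 * xs ! 1)" by simp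
qed

lemma recursive_in_diff [rec_intros]:
  assumes "recursive_in A k f" "recursive_in A k g"
  shows "recursive_in A k (\<lambda>xs. f xs - g xs)"
proof (rule recursive_in_compose2[OF _ assms])
  have pred: "rec_nat 0 (\<lambda>i r. i) a = a - 1" for a :: nat by (cases a) auto
  have "rec_nat a (\<lambda>i r. rec_nat 0 (\<lambda>i r. i) r) b = a - b" for a b :: nat
    by (induction b) (auto simp: pred)
  moreover have "recursive_in A 2 (\<lambda>xs. rec_nat (xs ! 0) (\<lambda>i r. rec_nat 0 (\<lambda>i r. i) r) (xs ! 1))"
    by (intro rec_intros) auto
  ultimately show "recursive_in A 2 (\<lambda>xs. xs ! 0 - xs ! 1)" by simp
qed

lemma recursive_in_power [rec_intros]:
  assumes "recursive_in A k f" "recursive_in A k g"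
  shows "recursive_in A k (\<lambda>xs. f xs ^ g xs)"
proof (rule recursive_in_compose2[OF _ assms])
  have "rec_nat 1 (\<lambda>i r. r * a) b = a ^ b" for a b :: nat by (induction b) auto
  moreover have "recursive_in A 2 (\<lambda>xs. rec_nat 1 (\<lambda>i r. r * xs ! 0) (xs ! 1))"
    by (intro rec_intros) auto
  ultimately show "recursive_in A 2 (\<lambda>xs. (xs ! 0) ^ (xs ! 1))" by simp
qed

lemma recursive_in_if [rec_intros]:
  assumes "decidable_in A k P" "recursive_in A k f" "recursive_in A k g"
  shows "recursive_in A k (\<lambda>xs. if P xs then f xs else g xs)"
proof -
  have "recursive_in A k (\<lambda>xs. of_bool (P xs) * f xs + (1 - of_bool (P xs)) * g xs)"
    using assms(1) by (intro rec_intros assms(2,3)) (auto simp: decidable_in_def)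
  then show ?thesis by (rule recursive_in_cong) auto
qed

lemma decidable_in_not [rec_intros]:
  assumes "decidable_in A k P"
  shows "decidable_in A k (\<lambda>xs. \<not> P xs)"
proof -
  have "recursive_in A k (\<lambda>xs. 1 - of_bool (P xs))"
    using assms by (intro rec_intros) (auto simp: decidable_in_def)
  then show ?thesis unfolding decidable_in_def by (rule recursive_in_cong) auto
qed

lemma decidable_in_and [rec_intros]:
  assumes "decidable_in A k P" "decidable_in A k Q"
  shows "decidable_in A k (\<lambda>xs. P xs \<and> Q xs)"
proof -
  have "recursive_in A k (\<lambda>xs. of_bool (P xs) * of_bool (Q xs))"
    using assms by (intro rec_intros) (auto simp: decidable_in_def)
  then show ?thesis unfolding decidable_in_def by (rule recursive_in_cong) auto
qed

lemma decidable_in_or [rec_intros]: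
  assumes "decidable_in A k P" "decidable_in A k Q"
  shows "decidable_in A k (\<lambda>xs. P xs \<or> Q xs)"
proof -
  have "decidable_in A k (\<lambda>xs. \<not> (\<not> P xs \<and> \<not> Q xs))"
    by (intro decidable_in_not decidable_in_and assms)
  then show ?thesis by simp
qed

lemma decidable_in_imp [rec_intros]:
  assumes "decidable_in A k P" "decidable_in A k Q"
  shows "decidable_in A k (\<lambda>xs. P xs \<longrightarrow> Q xs)"
proof -
  have "decidable_in A k (\<lambda>xs. \<not> P xs \<or> Q xs)"
    by (intro decidable_in_not decidable_in_or assms)
  then show ?thesis by (simp only: imp_conv_disj)
qed

lemma decidable_in_le [rec_intros]:
  assumes "recursive_in A k f" "recursive_in A k g"
  shows "decidable_in A k (\<lambda>xs. f xs \<le> g xs)"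
proof -
  have "recursive_in A k (\<lambda>xs. 1 - (f xs - g xs))" by (intro rec_intros assms)
  then show ?thesis unfolding decidable_in_def by (rule recursive_in_cong) auto
qed

lemma decidable_in_less [rec_intros]:
  assumes "recursive_in A k f" "recursive_in A k g"
  shows "decidable_in A k (\<lambda>xs. f xs < g xs)"
  using decidable_in_not[OF decidable_in_le[OF assms(2,1)]] by (simp add: not_le)

lemma decidable_in_eq [rec_intros]:
  assumes "recursive_in A k f" "recursive_in A k g"
  shows "decidable_in A k (\<lambda>xs. f xs = g xs)"
  using decidable_in_and[OF decidable_in_le[OF assms] decidable_in_le[OF assms(2,1)]]
  by (simp add: order_eq_iff)

lemma decidable_in_all_less [rec_intros]:
  assumes "recursive_in A k b" "decidable_in A (Suc k) (\<lambda>ys. P (ys ! 0) (tl ys))"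
  shows "decidable_in A k (\<lambda>xs. \<forall>i<b xs. P i xs)"
proof -
  have "rec_nat (1::nat) (\<lambda>i r. if Q i then r else 0) n = of_bool (\<forall>i<n. Q i)" for n and Q :: "nat \<Rightarrow> bool"
    by (induction n) (auto simp: less_Suc_eq)
  moreover have "decidable_in A (Suc (Suc k)) (\<lambda>ys. P (ys ! 0) (tl (tl ys)))"
    using assms(2) unfolding decidable_in_def by (rule recursive_in_skip)
  then have "recursive_in A k (\<lambda>xs. rec_nat 1 (\<lambda>i r. if P i xs then r else 0) (b xs))"
    by (intro rec_intros assms(1)) auto
  ultimately show ?thesis unfolding decidable_in_def by (simp only:)
qed

lemma decidable_in_ex_less [rec_intros]:
  assumes "recursive_in A k b" "decidable_in A (Suc k) (\<lambda>ys. P (ys ! 0) (tl ys))"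
  shows "decidable_in A k (\<lambda>xs. \<exists>i<b xs. P i xs)"
  using decidable_in_not[OF decidable_in_all_less[OF assms(1) decidable_in_not[OF assms(2)]]] by simp

lemma decidable_in_all_le [rec_intros]:
  assumes "recursive_in A k b" "decidable_in A (Suc k) (\<lambda>ys. P (ys ! 0) (tl ys))"
  shows "decidable_in A k (\<lambda>xs. \<forall>i\<le>b xs. P i xs)"
  using decidable_in_all_less[OF recursive_in_Suc[OF assms(1)] assms(2)] by (simp add: less_Suc_eq_le)

lemma recursive_in_sum [rec_intros]:
  assumes "recursive_in A k b" "recursive_in A (Suc k) (\<lambda>ys. f (ys ! 0) (tl ys))"
  shows "recursive_in A k (\<lambda>xs. \<Sum>i<b xs. f i xs)"
proof -
  have "rec_nat 0 (\<lambda>i r. r + g i) n = (\<Sum>i<n. g i)" for n and g :: "nat \<Rightarrow> nat"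
    by (induction n) auto
  moreover have "recursive_in A k (\<lambda>xs. rec_nat 0 (\<lambda>i r. r + f i xs) (b xs))"
    by (intro rec_intros assms(1) recursive_in_skip[OF assms(2)]) auto
  ultimately show ?thesis by simp
qed

lemma eval_Mu_Least:
  assumes "\<exists>j. P j" "\<And>j. eval A e (j # xs) (of_bool (\<not> P j))"
  shows "eval A (Mu e) xs (LEAST j. P j)"
proof (rule eval.Mu)
  show "eval A e ((LEAST j. P j) # xs) 0" using assms(2)[of "LEAST j. P j"] LeastI_ex[OF assms(1)] by simp
  show "\<forall>m<LEAST j. P j. \<exists>y. eval A e (m # xs) (Suc y)"
  proof (intro allI impI)
    fix m assume "m < (LEAST j. P j)"
    then have "\<not> P m" by (rule not_less_Least)
    then show "\<exists>y. eval A e (m # xs) (Suc y)" using assms(2)[of m] by auto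
  qed
qed

lemma recursive_in_Least:
  assumes "\<And>xs. length xs = k \<Longrightarrow> \<exists>j. P j xs" "decidable_in A (Suc k) (\<lambda>ys. P (ys ! 0) (tl ys))"
  shows "recursive_in A k (\<lambda>xs. LEAST j. P j xs)"
proof -
  obtain e where e: "\<And>ys. length ys = Suc k \<Longrightarrow> eval A e ys (of_bool (\<not> P (ys ! 0) (tl ys)))"
    using decidable_in_not[OF assms(2)] unfolding decidable_in_def recursive_in_def by auto
  have "eval A (Mu e) xs (LEAST j. P j xs)" if "length xs = k" for xs
    using e[of "_ # xs"] that by (intro eval_Mu_Least assms(1)) auto
  then show ?thesis unfolding recursive_in_def by blast
qed

text \<open>\<open>partial_recursive\<close> also demands divergence where no witness exists: a
  halting run of the composition contains a halting run of \<open>Mu\<close>, which exhibits a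
  witness.\<close>

lemma partial_recursive_search:
  assumes "decidable_in Map.empty 2 (\<lambda>ys. P (ys ! 0) (ys ! 1))"
    and "recursive_in Map.empty 2 (\<lambda>ys. g (ys ! 0) (ys ! 1))"
  shows "partial_recursive (\<lambda>x. if \<exists>p. P p x then Some (g (LEAST p. P p x) x) else None)"
proof -
  obtain e where e: "\<And>ys. length ys = 2 \<Longrightarrow> eval Map.empty e ys (of_bool (\<not> P (ys ! 0) (ys ! 1)))"
    using decidable_in_not[OF assms(1)] unfolding decidable_in_def recursive_in_def by auto
  obtain e' where e': "\<And>ys. length ys = 2 \<Longrightarrow> eval Map.empty e' ys (g (ys ! 0) (ys ! 1))"
    using assms(2) unfolding recursive_in_def by auto
  have e2: "eval Map.empty e [p, x] (of_bool (\<not> P p x))" for p x using e[of "[p, x]"] by simp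
  let ?E = "Comp e' [Mu e, Proj 0]"
  have *: "eval Map.empty ?E [x] (g (LEAST p. P p x) x)" if "\<exists>p. P p x" for x
  proof -
    have "eval Map.empty (Mu e) [x] (LEAST p. P p x)"
      by (rule eval_Mu_Least[OF that]) (simp add: e2)
    moreover have "eval Map.empty (Proj 0) [x] x" using eval.Proj[of 0 "[x]"] by simp
    ultimately show ?thesis using e'[of "[LEAST p. P p x, x]"]
      by (intro eval.Comp[where ys = "[LEAST p. P p x, x]"]) auto
  qed
  have "\<exists>p. P p x" if "eval Map.empty ?E [x] y" for x y
  proof -
    from that obtain n where "eval Map.empty (Mu e) [x] n"
      by cases (auto simp: list_all2_Cons1)
    then have "eval Map.empty e [n, x] 0" by cases
    with e2[of n x] have "of_bool (\<not> P n x) = (0::nat)" by (rule eval_determ)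
    then show ?thesis by auto
  qed
  then have "eval Map.empty ?E [x] y \<longleftrightarrow> (\<exists>p. P p x) \<and> g (LEAST p. P p x) x = y" for x y
    using * eval_determ by blast
  then show ?thesis unfolding partial_recursive_def by (intro exI[of _ ?E]) simp
qed

lemma recursive_in_div [rec_intros]:
  assumes "recursive_in A k f" "recursive_in A k g"
  shows "recursive_in A k (\<lambda>xs. f xs div g xs)"
proof (rule recursive_in_compose2[OF _ assms])
  \<comment> \<open>The disjunct \<open>y = 0\<close> makes the search total and returns 0, the
    value of division by zero.\<close>
  have "(LEAST q. y = 0 \<or> x < Suc q * y) = x div y" for x y :: nat
  proof (cases "y = 0")
    case False
    have "(y = 0 \<or> x < Suc q * y) \<longleftrightarrow> x div y \<le> q" for q
      using div_less_iff_less_mult[of y x "Suc q"] False by (simp only: less_Suc_eq_le) simp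
    then show ?thesis by (simp only:) (rule Least_equality, simp_all)
  next
    case True
    have "(LEAST q::nat. True) = 0" by (rule Least_equality) simp_all
    with True show ?thesis by simp
  qed
  moreover have "recursive_in A 2 (\<lambda>xs. LEAST q. xs ! 1 = 0 \<or> xs ! 0 < Suc q * xs ! 1)"
  proof (rule recursive_in_Least)
    show "\<exists>q. xs ! 1 = 0 \<or> xs ! 0 < Suc q * xs ! 1" for xs :: "nat list"
      by (intro exI[of _ "xs ! 0"]) (cases "xs ! 1"; simp)
  qed (intro rec_intros; simp)+
  ultimately show "recursive_in A 2 (\<lambda>xs. xs ! 0 div xs ! 1)" by simp
qed

lemma recursive_in_mod [rec_intros]:
  assumes "recursive_in A k f" "recursive_in A k g"
  shows "recursive_in A k (\<lambda>xs. f xs mod g xs)"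
proof -
  have "recursive_in A k (\<lambda>xs. f xs - f xs div g xs * g xs)"
    by (intro rec_intros assms)
  then show ?thesis by (simp only: minus_div_mult_eq_mod)
qed

section \<open>Step-bounded computation\<close>

text \<open>
  The value 0 means that the computation has not halted within the bound \<open>s\<close>, and \<open>Suc y\<close> means
  that it has returned \<open>y\<close>. Only the searches of \<open>Mu\<close> have to be cut off.
\<close>

fun approx :: "recf \<Rightarrow> nat \<Rightarrow> nat list \<Rightarrow> nat" where
  "approx Zero s xs = 1"
| "approx Succ s xs = (if length xs = 1 then Suc (Suc (xs ! 0)) else 0)"
| "approx (Proj i) s xs = (if i < length xs then Suc (xs ! i) else 0)"
| "approx Query s xs = 0"
| "approx (Comp f gs) s xs =
     (if 0 \<in> set (map (\<lambda>g. approx g s xs) gs) then 0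
      else approx f s (map (\<lambda>g. approx g s xs - 1) gs))"
| "approx (PrimRec f g) s [] = 0"
| "approx (PrimRec f g) s (n # xs) =
     rec_nat (approx f s xs) (\<lambda>i r. if r = 0 then 0 else approx g s (i # (r - 1) # xs)) n"
| "approx (Mu f) s xs =
     (let n = (LEAST n. s \<le> n \<or> approx f s (n # xs) \<le> 1)
      in if n < s \<and> approx f s (n # xs) = 1 then Suc n else 0)"

text \<open>The search stops at the first value 0 (no answer within the bound) or 1 (answer zero),
  and only the latter is a success.\<close>

lemma approx_Mu_iff:
  "approx (Mu f) s xs = Suc y \<longleftrightarrow>
     y < s \<and> approx f s (y # xs) = 1 \<and> (\<forall>m<y. 1 < approx f s (m # xs))"
proof
  define P where "P n \<longleftrightarrow> s \<le> n \<or> approx f s (n # xs) \<le> 1" for n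
  assume "approx (Mu f) s xs = Suc y"
  then have y: "y = (LEAST n. P n)" "y < s" "approx f s (y # xs) = 1"
    by (auto simp: Let_def P_def split: if_splits)
  have "1 < approx f s (m # xs)" if "m < y" for m
    using not_less_Least[of m P] that y(1) unfolding P_def by auto
  with y show "y < s \<and> approx f s (y # xs) = 1 \<and> (\<forall>m<y. 1 < approx f s (m # xs))" by auto
next
  assume *: "y < s \<and> approx f s (y # xs) = 1 \<and> (\<forall>m<y. 1 < approx f s (m # xs))"
  have "(LEAST n. s \<le> n \<or> approx f s (n # xs) \<le> 1) = y"
  proof (rule Least_equality)
    show "s \<le> y \<or> approx f s (y # xs) \<le> 1" using * by simp
    show "y \<le> n" if "s \<le> n \<or> approx f s (n # xs) \<le> 1" for n
      using * that by (meson le_trans less_or_eq_imp_le not_le)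
  qed
  with * show "approx (Mu f) s xs = Suc y" by (simp add: Let_def)
qed

lemma approx_mono: "approx e s xs = Suc y \<Longrightarrow> s \<le> t \<Longrightarrow> approx e t xs = Suc y"
proof (induction e arbitrary: xs y)
  case (Comp f gs)
  have pos: "approx g s xs \<noteq> 0" if "g \<in> set gs" for g
    using Comp.prems(1) that by (force split: if_splits)
  have eq: "approx g t xs = approx g s xs" if "g \<in> set gs" for g
    using pos[OF that] Comp.IH(2)[OF that _ Comp.prems(2), of xs] by (metis not0_implies_Suc)
  have "map (\<lambda>g. approx g t xs) gs = map (\<lambda>g. approx g s xs) gs"
    "map (\<lambda>g. approx g t xs - 1) gs = map (\<lambda>g. approx g s xs - 1) gs"
    using eq by auto
  moreover have "0 \<notin> set (map (\<lambda>g. approx g s xs) gs)" using pos by force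
  ultimately show ?case using Comp.prems Comp.IH(1) by (simp only: approx.simps if_False)
next
  case (PrimRec f g)
  from PrimRec.prems obtain n zs where xs: "xs = n # zs" by (cases xs) auto
  define p where "p s n = approx (PrimRec f g) s (n # zs)" for s n
  have p_simps: "p s 0 = approx f s zs"
    "p s (Suc n) = (if p s n = 0 then 0 else approx g s (n # (p s n - 1) # zs))" for s n
    by (simp_all add: p_def)
  have "p s n \<noteq> 0 \<Longrightarrow> p t n = p s n" for n
  proof (induction n)
    case 0
    then show ?case using PrimRec.IH(1)[OF _ PrimRec.prems(2)] by (metis p_simps(1) not0_implies_Suc)
  next
    case (Suc n)
    then have n: "p s n \<noteq> 0" by (auto simp: p_simps split: if_splits)
    then have "p s (Suc n) = approx g s (n # (p s n - 1) # zs)" by (simp add: p_simps)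
    moreover have "p t (Suc n) = approx g t (n # (p s n - 1) # zs)" using n Suc.IH by (simp add: p_simps)
    ultimately show ?case using PrimRec.IH(2)[OF _ PrimRec.prems(2)] Suc.prems
      by (metis not0_implies_Suc)
  qed
  from this[of n] PrimRec.prems(1) show ?case unfolding xs p_def by simp
next
  case (Mu f)
  from Mu.prems(1)[unfolded approx_Mu_iff] have
    y: "y < s" "approx f s (y # xs) = 1" "\<And>m. m < y \<Longrightarrow> 1 < approx f s (m # xs)" by auto
  have "approx f t (m # xs) = approx f s (m # xs)" if "approx f s (m # xs) \<noteq> 0" for m
    using Mu.IH[OF _ Mu.prems(2)] that by (metis not0_implies_Suc)
  with y Mu.prems(2) show ?case unfolding approx_Mu_iff by force
qed (auto split: if_splits)

lemma approx_sound: "approx e s xs = Suc y \<Longrightarrow> eval Map.empty e xs y"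
proof (induction e arbitrary: xs y)
  case (Comp f gs)
  have pos: "approx g s xs \<noteq> 0" if "g \<in> set gs" for g
    using Comp.prems that by (force split: if_splits)
  then have "approx f s (map (\<lambda>g. approx g s xs - 1) gs) = Suc y"
    using Comp.prems by (simp split: if_splits)
  then have "eval Map.empty f (map (\<lambda>g. approx g s xs - 1) gs) y" by (rule Comp.IH(1))
  moreover have "eval Map.empty g xs (approx g s xs - 1)" if "g \<in> set gs" for g
    using pos[OF that] by (intro Comp.IH(2)[OF that]) simp
  then have "list_all2 (\<lambda>g y. eval Map.empty g xs y) gs (map (\<lambda>g. approx g s xs - 1) gs)"
    by (simp add: list_all2_conv_all_nth)
  ultimately show ?case by (rule eval.Comp[rotated])
next
  case (PrimRec f g)
  from PrimRec.prems obtain n zs where xs: "xs = n # zs" by (cases xs) auto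
  have "approx (PrimRec f g) s (n # zs) = Suc y \<Longrightarrow> eval Map.empty (PrimRec f g) (n # zs) y" for n y
  proof (induction n arbitrary: y)
    case 0
    then show ?case by (intro eval.PrimRec_0 PrimRec.IH(1)) simp
  next
    case (Suc n)
    define r where "r = approx (PrimRec f g) s (n # zs)"
    from Suc.prems have r: "r \<noteq> 0" "approx g s (n # (r - 1) # zs) = Suc y"
      by (auto simp: r_def split: if_splits)
    from r(1) have "eval Map.empty (PrimRec f g) (n # zs) (r - 1)"
      by (intro Suc.IH) (simp add: r_def)
    then show ?case using PrimRec.IH(2)[OF r(2)] by (rule eval.PrimRec_Suc)
  qed
  with PrimRec.prems show ?case unfolding xs by blast
next
  case (Mu f)
  from Mu.prems[unfolded approx_Mu_iff] have
    y: "y < s" "approx f s (y # xs) = 1" "\<And>m. m < y \<Longrightarrow> 1 < approx f s (m # xs)" by auto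
  show ?case
  proof (rule eval.Mu)
    show "eval Map.empty f (y # xs) 0" by (rule Mu.IH) (simp add: y)
    show "\<forall>m<y. \<exists>y. eval Map.empty f (m # xs) (Suc y)"
      using y(3) Mu.IH by (metis less_imp_Suc_add add_Suc_right plus_1_eq_Suc)
  qed
qed (auto split: if_splits simp: length_Suc_conv intro: eval.Zero eval.Succ eval.Proj)

lemma approx_complete: "eval A e xs y \<Longrightarrow> A = Map.empty \<Longrightarrow> \<exists>s. approx e s xs = Suc y"
proof (induction rule: eval.induct)
  case (Comp xs gs ys f z)
  have len: "length gs = length ys" using Comp.IH(1) by (simp add: list_all2_conv_all_nth)
  have "\<forall>i<length gs. \<exists>s. approx (gs ! i) s xs = Suc (ys ! i)"
    using Comp.IH(1) Comp.prems by (simp add: list_all2_conv_all_nth)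
  then obtain h where h: "\<And>i. i < length gs \<Longrightarrow> approx (gs ! i) (h i) xs = Suc (ys ! i)"
    by metis
  obtain s0 where s0: "approx f s0 ys = Suc z" using Comp.IH(2) Comp.prems by blast
  define s where "s = Max (insert s0 (h ` {..<length gs}))"
  have "s0 \<le> s" unfolding s_def by simp
  have gs: "approx (gs ! i) s xs = Suc (ys ! i)" if "i < length gs" for i
  proof (rule approx_mono[OF h[OF that]])
    show "h i \<le> s" unfolding s_def using that by (intro Max_ge) auto
  qed
  have "map (\<lambda>g. approx g s xs) gs = map Suc ys"
    using gs len by (intro nth_equalityI) simp_all
  moreover have "map (\<lambda>g. approx g s xs - 1) gs = ys"
    using gs len by (intro nth_equalityI) simp_all
  moreover have "0 \<notin> set (map Suc ys)" by auto
  ultimately have "approx (Comp f gs) s xs = approx f s ys"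
    by (simp only: approx.simps if_False)
  also have "\<dots> = Suc z" using approx_mono[OF s0 \<open>s0 \<le> s\<close>] .
  finally show ?case by blast
next
  case (PrimRec_0 f xs z g)
  then show ?case by auto
next
  case (PrimRec_Suc f g n xs y z)
  then obtain s1 s2 where s: "approx (PrimRec f g) s1 (n # xs) = Suc y" "approx g s2 (n # y # xs) = Suc z"
    by blast
  define s where "s = max s1 s2"
  have "approx (PrimRec f g) s (n # xs) = Suc y" "approx g s (n # y # xs) = Suc z"
    using approx_mono[OF s(1), of s] approx_mono[OF s(2), of s] by (simp_all add: s_def)
  then have "approx (PrimRec f g) s (Suc n # xs) = Suc z" by simp
  then show ?case by blast
next
  case (Mu f n xs)
  then obtain s0 where s0: "approx f s0 (n # xs) = 1" by auto
  have "\<forall>m<n. \<exists>s. 1 < approx f s (m # xs)" using Mu.IH(2) Mu.prems by (metis One_nat_def Suc_less_eq zero_less_Suc)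
  then obtain h where h: "\<And>m. m < n \<Longrightarrow> 1 < approx f (h m) (m # xs)" by metis
  define s where "s = Max (insert s0 (insert (Suc n) (h ` {..<n})))"
  have "s0 \<le> s" "Suc n \<le> s" unfolding s_def by (intro Max_ge; simp)+
  have "1 < approx f s (m # xs)" if "m < n" for m
  proof -
    have "h m \<le> s" unfolding s_def using that by (intro Max_ge) auto
    then show ?thesis using h[OF that] approx_mono[of f "h m" "m # xs" _ s]
      by (metis less_nat_zero_code not0_implies_Suc)
  qed
  then have "approx (Mu f) s xs = Suc n"
    unfolding approx_Mu_iff using approx_mono[OF _ \<open>s0 \<le> s\<close>] s0 \<open>Suc n \<le> s\<close> by simp
  then show ?case by blast
qed auto

lemma recursive_in_compose_approx:
  assumes "recursive_in A (Suc (length hs)) (\<lambda>ys. approx f (ys ! 0) (tl ys))"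
    "recursive_in A k a" "\<And>h. h \<in> set hs \<Longrightarrow> recursive_in A k h"
  shows "recursive_in A k (\<lambda>xs. approx f (a xs) (map (\<lambda>h. h xs) hs))"
  using recursive_in_compose[of A "a # hs" "\<lambda>ys. approx f (ys ! 0) (tl ys)" k] assms by auto

lemma map_nth_upt_drop: "length xs = j + k \<Longrightarrow> map (\<lambda>i. xs ! (i + j)) [0..<k] = drop j xs"
  by (intro nth_equalityI) (auto simp: add.commute)

text \<open>The induction is on the fixed program, so no numbering of programs enters. The arity is
  generalised because subprograms run on lists of other lengths.\<close>

lemma recursive_in_approx: "recursive_in A (Suc k) (\<lambda>ys. approx e (ys ! 0) (tl ys))"
proof (induction e arbitrary: k)
  case Zero
  show ?case by (simp add: recursive_in_const)
next
  case Succ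
  show ?case
  proof (cases "k = 1")
    case True
    have "recursive_in A (Suc k) (\<lambda>ys. Suc (Suc (ys ! 1)))" using True by (intro rec_intros) simp
    then show ?thesis by (rule recursive_in_cong) (simp add: True nth_tl)
  next
    case False
    show ?thesis by (rule recursive_in_cong[OF recursive_in_const[of A _ 0]]) (use False in simp)
  qed
next
  case (Proj i)
  show ?case
  proof (cases "i < k")
    case True
    have "recursive_in A (Suc k) (\<lambda>ys. Suc (ys ! Suc i))" using True by (intro rec_intros) simp
    then show ?thesis by (rule recursive_in_cong) (simp add: True nth_tl)
  next
    case False
    show ?thesis by (rule recursive_in_cong[OF recursive_in_const[of A _ 0]]) (simp add: False)
  qed
next
  case Query
  show ?case by (simp add: recursive_in_const)
next
  case (Comp f gs)
  have dec: "decidable_in A (Suc k) (\<lambda>ys. 0 \<in> set (map (\<lambda>g. approx g (ys ! 0) (tl ys)) gs'))"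
    if "set gs' \<subseteq> set gs" for gs'
    using that
  proof (induction gs')
    case Nil
    have "decidable_in A (Suc k) (\<lambda>ys. 0 \<noteq> (0::nat))" by (intro rec_intros)
    then show ?case by simp
  next
    case (Cons g gs')
    have "decidable_in A (Suc k) (\<lambda>ys. 0 = approx g (ys ! 0) (tl ys) \<or>
        0 \<in> set (map (\<lambda>g. approx g (ys ! 0) (tl ys)) gs'))"
      using Cons by (intro decidable_in_or decidable_in_eq recursive_in_const Comp.IH(2)) auto
    then show ?case by simp
  qed
  have "recursive_in A (Suc k) (\<lambda>ys. approx f (ys ! 0)
      (map (\<lambda>h. h ys) (map (\<lambda>g ys. approx g (ys ! 0) (tl ys) - 1) gs)))"
  proof (rule recursive_in_compose_approx)
    show "recursive_in A (Suc k) h" if "h \<in> set (map (\<lambda>g ys. approx g (ys ! 0) (tl ys) - 1) gs)" for h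
      using that by (auto intro!: recursive_in_diff recursive_in_const[of _ _ "Suc 0"] Comp.IH(2))
  qed (auto intro: Comp.IH(1) rec_intros)
  then have "recursive_in A (Suc k) (\<lambda>ys. approx f (ys ! 0) (map (\<lambda>g. approx g (ys ! 0) (tl ys) - 1) gs))"
    by (simp add: comp_def)
  from recursive_in_if[OF dec[OF subset_refl] recursive_in_const this]
  show ?case by simp
next
  case (PrimRec f g)
  show ?case
  proof (cases k)
    case 0
    then have "approx (PrimRec f g) (ys ! 0) (tl ys) = 0" if "length ys = Suc k" for ys :: "nat list"
      using that by (cases ys) auto
    then show ?thesis by (intro recursive_in_cong[OF recursive_in_const[of A _ 0]]) simp
  next
    case (Suc k')
    \<comment> \<open>Positions in \<open>zs\<close>: 0 is the counter, 1 the previous value, 2 the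
      step bound, 3 the recursion argument, and from 4 on the parameters.\<close>
    have step: "recursive_in A (Suc (Suc (Suc k))) (\<lambda>zs.
        if zs ! 1 = 0 then 0 else approx g (tl (tl zs) ! 0) (zs ! 0 # (zs ! 1 - 1) # tl (tl (tl (tl zs)))))"
    proof -
      have "recursive_in A (Suc (Suc (Suc k))) (\<lambda>zs. approx g (tl (tl zs) ! 0)
        (map (\<lambda>h. h zs) ((\<lambda>zs. zs ! 0) # (\<lambda>zs. zs ! 1 - 1) # map (\<lambda>i zs. zs ! (i + 4)) [0..<k'])))"
        by (rule recursive_in_compose_approx) (auto simp: Suc intro!: PrimRec.IH(2) rec_intros)
      then have "recursive_in A (Suc (Suc (Suc k))) (\<lambda>zs. approx g (tl (tl zs) ! 0)
          (zs ! 0 # (zs ! 1 - 1) # tl (tl (tl (tl zs)))))"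
      proof (rule recursive_in_cong)
        fix zs :: "nat list" assume "length zs = Suc (Suc (Suc k))"
        then have "map (\<lambda>i. zs ! (i + 4)) [0..<k'] = drop 4 zs"
          by (intro map_nth_upt_drop) (simp add: Suc)
        then show "approx g (tl (tl zs) ! 0)
          (map (\<lambda>h. h zs) ((\<lambda>zs. zs ! 0) # (\<lambda>zs. zs ! 1 - 1) # map (\<lambda>i zs. zs ! (i + 4)) [0..<k']))
          = approx g (tl (tl zs) ! 0) (zs ! 0 # (zs ! 1 - 1) # tl (tl (tl (tl zs))))"
          by (simp add: comp_def drop_Suc numeral_eq_Suc)
      qed
      then show ?thesis by (intro recursive_in_if decidable_in_eq recursive_in_nth recursive_in_const) simp_all
    qed
    have "recursive_in A (Suc k) (\<lambda>ys. rec_nat (approx f (ys ! 0) (tl (tl ys)))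
        (\<lambda>i r. if r = 0 then 0 else approx g (ys ! 0) (i # (r - 1) # tl (tl ys))) (ys ! 1))"
    proof (rule recursive_in_rec_nat)
      show "recursive_in A (Suc k) (\<lambda>ys. ys ! 1)" by (rule recursive_in_nth) (simp add: Suc)
      show "recursive_in A (Suc k) (\<lambda>ys. approx f (ys ! 0) (tl (tl ys)))"
        unfolding Suc using PrimRec.IH(1)[of k'] by (rule recursive_in_skip)
    qed (use step in simp)
    then show ?thesis
    proof (rule recursive_in_cong)
      fix ys :: "nat list" assume "length ys = Suc k"
      then obtain s n zs where "ys = s # n # zs" by (auto simp: Suc length_Suc_conv)
      then show "rec_nat (approx f (ys ! 0) (tl (tl ys)))
        (\<lambda>i r. if r = 0 then 0 else approx g (ys ! 0) (i # (r - 1) # tl (tl ys))) (ys ! 1)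
        = approx (PrimRec f g) (ys ! 0) (tl ys)" by (simp cong: if_cong)
    qed
  qed
next
  case (Mu f)
  have f: "recursive_in A (Suc (Suc k)) (\<lambda>zs. approx f (tl zs ! 0) (zs ! 0 # tl (tl zs)))"
  proof -
    have "recursive_in A (Suc (Suc k)) (\<lambda>zs. approx f (tl zs ! 0)
        (map (\<lambda>h. h zs) ((\<lambda>zs. zs ! 0) # map (\<lambda>i zs. zs ! (i + 2)) [0..<k])))"
      by (rule recursive_in_compose_approx) (auto intro!: Mu rec_intros)
    then show ?thesis
    proof (rule recursive_in_cong)
      fix zs :: "nat list" assume "length zs = Suc (Suc k)"
      then have "map (\<lambda>i. zs ! (i + 2)) [0..<k] = drop 2 zs"
        by (intro map_nth_upt_drop) simp
      then show "approx f (tl zs ! 0)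
        (map (\<lambda>h. h zs) ((\<lambda>zs. zs ! 0) # map (\<lambda>i zs. zs ! (i + 2)) [0..<k]))
        = approx f (tl zs ! 0) (zs ! 0 # tl (tl zs))"
        by (simp add: comp_def drop_Suc numeral_eq_Suc)
    qed
  qed
  have least: "recursive_in A (Suc k) (\<lambda>ys. LEAST n. ys ! 0 \<le> n \<or> approx f (ys ! 0) (n # tl ys) \<le> 1)"
    by (rule recursive_in_Least) (auto intro!: rec_intros f recursive_in_const[of _ _ "Suc 0"])
  have "recursive_in A (Suc (Suc k)) (\<lambda>zs. if zs ! 0 < tl zs ! 0 \<and>
      approx f (tl zs ! 0) (zs ! 0 # tl (tl zs)) = 1 then Suc (zs ! 0) else 0)"
    by (intro rec_intros f) auto
  from recursive_in_cons[OF this least] show ?case by (simp add: Let_def cong: if_cong)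
qed

lemma partial_recursive_approx:
  assumes "partial_recursive f"
  obtains h where "\<And>A. recursive_in A 2 (\<lambda>ys. h (ys ! 0) (ys ! 1))"
    "\<And>s t x y. h s x = Suc y \<Longrightarrow> s \<le> t \<Longrightarrow> h t x = Suc y"
    "\<And>x y. f x = Some y \<longleftrightarrow> (\<exists>s. h s x = Suc y)"
proof -
  obtain e where e: "\<And>x y. eval Map.empty e [x] y \<longleftrightarrow> f x = Some y"
    using assms unfolding partial_recursive_def by blast
  show ?thesis
  proof (rule that[of "\<lambda>s x. approx e s [x]"])
    fix A
    show "recursive_in A 2 (\<lambda>ys. approx e (ys ! 0) [ys ! 1])"
    proof (rule recursive_in_cong)
      show "recursive_in A 2 (\<lambda>ys. approx e (ys ! 0) (tl ys))"
        using recursive_in_approx[of A 1 e] by (simp add: numeral_2_eq_2)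
      fix ys :: "nat list" assume "length ys = 2"
      then have "ys = [ys ! 0, ys ! 1]" by (intro nth_equalityI) (auto simp: less_2_cases_iff)
      then have "tl ys = [ys ! 1]" by (metis list.sel(3))
      then show "approx e (ys ! 0) (tl ys) = approx e (ys ! 0) [ys ! 1]" by simp
    qed
  next
    show "f x = Some y \<longleftrightarrow> (\<exists>s. approx e s [x] = Suc y)" for x y
      using e approx_sound approx_complete by blast
  qed (rule approx_mono)
qed

section \<open>Digits, pairs and string codes\<close>

text \<open>Tuples are coded as base-\<open>b\<close> expansions: quantifiers over tuples become
  bounded number quantifiers, and for \<open>b\<close> a power of 2 a tuple has no more bits than
  its entries together.\<close>

definition dig :: "nat \<Rightarrow> nat \<Rightarrow> nat \<Rightarrow> nat" where
  "dig b x i = x div b ^ i mod b"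

lemma dig_encode:
  "\<forall>i<a. t i < b \<Longrightarrow> \<exists>T<b ^ a. \<forall>i<a. dig b T i = t i"
proof (induction a arbitrary: t)
  case 0
  then show ?case by simp
next
  case (Suc a)
  from Suc.IH[of "\<lambda>i. t (Suc i)"] Suc.prems
  obtain T where T: "T < b ^ a" "\<forall>i<a. dig b T i = t (Suc i)" by auto
  have t0: "t 0 < b" using Suc.prems by simp
  have "dig b (t 0 + b * T) (Suc i) = dig b T i" for i
    using t0 by (simp add: dig_def div_mult2_eq)
  moreover have "dig b (t 0 + b * T) 0 = t 0" using t0 by (simp add: dig_def)
  moreover have "t 0 + b * T < b ^ Suc a"
  proof -
    have "t 0 + b * T < b * Suc T" using t0 by simp
    also have "\<dots> \<le> b * b ^ a" using T(1) by (intro mult_left_mono) auto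
    finally show ?thesis by simp
  qed
  ultimately show ?case using T(2) by (intro exI[of _ "t 0 + b * T"]) (auto simp: less_Suc_eq_0_disj)
qed

lemma recursive_in_dig [rec_intros]:
  "recursive_in A k b \<Longrightarrow> recursive_in A k x \<Longrightarrow> recursive_in A k i \<Longrightarrow>
    recursive_in A k (\<lambda>xs. dig (b xs) (x xs) (i xs))"
  unfolding dig_def by (intro rec_intros)

text \<open>Since \<open>(u + w)\<^sup>2 \<le> pair u w < (u + w + 1)\<^sup>2\<close>, the sum
  \<open>u + w\<close> is the integer square root of the code, which \<open>pair_root\<close>
  finds.\<close>

definition pair :: "nat \<Rightarrow> nat \<Rightarrow> nat" where
  "pair u w = (u + w)\<^sup>2 + u"

definition pair_root :: "nat \<Rightarrow> nat" where
  "pair_root x = (LEAST r. x < (r + 1)\<^sup>2)"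

definition left :: "nat \<Rightarrow> nat" where
  "left x = x - (pair_root x)\<^sup>2"

definition right :: "nat \<Rightarrow> nat" where
  "right x = pair_root x - left x"

lemma pair_root_pair: "pair_root (pair u w) = u + w"
  unfolding pair_root_def
proof (rule Least_equality)
  show "pair u w < (u + w + 1)\<^sup>2" by (simp add: pair_def power2_eq_square)
  show "u + w \<le> r" if "pair u w < (r + 1)\<^sup>2" for r
  proof (rule ccontr)
    assume "\<not> u + w \<le> r"
    then have "(r + 1)\<^sup>2 \<le> (u + w)\<^sup>2" by (intro power_mono) auto
    with that show False unfolding pair_def by linarith
  qed
qed

lemma left_pair [simp]: "left (pair u w) = u"
  by (simp add: left_def pair_root_pair) (simp add: pair_def)

lemma right_pair [simp]: "right (pair u w) = w"
  by (simp add: right_def pair_root_pair)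

text \<open>Pairing doubles the bit length up to two extra bits. The size of the queries to
  \<open>Y\<close> depends on this.\<close>

lemma pair_less:
  assumes "u < 2 ^ e" "w < 2 ^ e"
  shows "pair u w < 2 ^ (2 * e + 2)"
proof -
  have "pair u w < (u + w + 1)\<^sup>2" by (simp add: pair_def power2_eq_square)
  also have "\<dots> \<le> (2 ^ Suc e)\<^sup>2" using assms by (intro power_mono) auto
  also have "\<dots> = 2 ^ (2 * e + 2)" by (simp flip: power_mult)
  finally show ?thesis .
qed

lemma recursive_in_pair [rec_intros]:
  "recursive_in A k f \<Longrightarrow> recursive_in A k g \<Longrightarrow> recursive_in A k (\<lambda>xs. pair (f xs) (g xs))"
  unfolding pair_def by (intro rec_intros)

lemma recursive_in_pair_root [rec_intros]:
  assumes "recursive_in A k f"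
  shows "recursive_in A k (\<lambda>xs. pair_root (f xs))"
proof (rule recursive_in_compose1[OF _ assms])
  have "recursive_in A 1 (\<lambda>xs. LEAST r. xs ! 0 < (r + 1)\<^sup>2)"
  proof (rule recursive_in_Least)
    show "\<exists>r. xs ! 0 < (r + 1)\<^sup>2" for xs :: "nat list"
      by (rule exI[of _ "xs ! 0"]) (simp add: power2_eq_square)
  qed (intro rec_intros; simp)+
  then show "recursive_in A 1 (\<lambda>xs. pair_root (xs ! 0))" by (simp add: pair_root_def)
qed

lemma recursive_in_left [rec_intros]:
  "recursive_in A k f \<Longrightarrow> recursive_in A k (\<lambda>xs. left (f xs))"
  unfolding left_def by (intro rec_intros)

lemma recursive_in_right [rec_intros]:
  "recursive_in A k f \<Longrightarrow> recursive_in A k (\<lambda>xs. right (f xs))"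
  unfolding right_def by (intro rec_intros)

text \<open>The strings of length \<open>l\<close> have the codes from \<open>2 ^ l - 1\<close> to
  \<open>2 ^ Suc l - 2\<close>, so this is the length of the string with code
  \<open>x\<close>.\<close>

definition code_length :: "nat \<Rightarrow> nat" where
  "code_length x = (LEAST l. x + 2 \<le> 2 ^ Suc l)"

lemma str_code_bounds: "2 ^ length \<sigma> \<le> str_code \<sigma> + 1" "str_code \<sigma> + 2 \<le> 2 ^ Suc (length \<sigma>)"
  by (induction \<sigma>) auto

lemma code_length_str_code [simp]: "code_length (str_code \<sigma>) = length \<sigma>"
  unfolding code_length_def
proof (rule Least_equality)
  show "length \<sigma> \<le> l" if "str_code \<sigma> + 2 \<le> 2 ^ Suc l" for l
  proof (rule ccontr)
    assume "\<not> length \<sigma> \<le> l"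
    then have "(2::nat) ^ Suc l \<le> 2 ^ length \<sigma>" by (intro power_increasing) auto
    with that str_code_bounds(1)[of \<sigma>] show False by simp
  qed
qed (use str_code_bounds in auto)

lemma code_length_le: "code_length x \<le> x"
  unfolding code_length_def
proof (rule Least_le)
  show "x + 2 \<le> 2 ^ Suc x" by (induction x) auto
qed

lemma recursive_in_code_length [rec_intros]:
  assumes "recursive_in A k f"
  shows "recursive_in A k (\<lambda>xs. code_length (f xs))"
proof (rule recursive_in_compose1[OF _ assms])
  have "recursive_in A 1 (\<lambda>xs. LEAST l. xs ! 0 + 2 \<le> 2 ^ Suc l)"
  proof (rule recursive_in_Least)
    show "\<exists>l. xs ! 0 + 2 \<le> 2 ^ Suc l" for xs :: "nat list"
    proof (rule exI[of _ "xs ! 0"])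
      show "xs ! 0 + 2 \<le> 2 ^ Suc (xs ! 0)" using less_exp[of "Suc (xs ! 0)"] by linarith
    qed
  qed (intro rec_intros; simp)+
  then show "recursive_in A 1 (\<lambda>xs. code_length (xs ! 0))" by (simp add: code_length_def)
qed

lemma inj_str_code: "str_code \<sigma> = str_code \<tau> \<Longrightarrow> \<sigma> = \<tau>"
proof (induction \<sigma> arbitrary: \<tau>)
  case Nil
  then show ?case by (cases \<tau>) (auto split: if_splits)
next
  case (Cons b \<sigma>)
  then obtain b' \<tau>' where \<tau>: "\<tau> = b' # \<tau>'" by (cases \<tau>) (auto split: if_splits)
  have eq: "2 * str_code \<sigma> + (if b then 2 else 1) = 2 * str_code \<tau>' + (if b' then 2 else 1)"
    using Cons.prems by (simp add: \<tau>)
  have "b = b'" using eq by (cases b; cases b'; simp; presburger)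
  with eq Cons.IH[of \<tau>'] show ?case by (simp add: \<tau>)
qed

lemma surj_str_code: "\<exists>\<sigma>. str_code \<sigma> = x"
proof (induction x rule: less_induct)
  case (less x)
  show ?case
  proof (cases "x = 0")
    case True
    then show ?thesis by (intro exI[of _ "[]"]) simp
  next
    case False
    then obtain \<sigma> where "str_code \<sigma> = (x - 1) div 2" using less[of "(x - 1) div 2"] by (meson diff_less div_le_dividend le_less_trans less_one neq0_conv)
    then have "str_code (even x # \<sigma>) = x" using False by auto
    then show ?thesis by blast
  qed
qed

text \<open>In binary, \<open>Suc (str_code \<sigma>)\<close> is a leading 1 above the letters of
  \<sigma>, the first letter being least significant. Prefixes thus become residues modulo powers of
  2.\<close>

lemma str_code_mod:
  assumes "m \<le> length \<sigma>" "v < 2 ^ m" "\<forall>i<m. \<sigma> ! i \<longleftrightarrow> odd (v div 2 ^ i)"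
  shows "Suc (str_code \<sigma>) mod 2 ^ m = v"
  using assms
proof (induction \<sigma> arbitrary: m v)
  case Nil
  then show ?case by simp
next
  case (Cons b \<sigma>)
  show ?case
  proof (cases m)
    case 0
    then show ?thesis using Cons.prems by simp
  next
    case (Suc m')
    have "Suc (str_code \<sigma>) mod 2 ^ m' = v div 2"
    proof (rule Cons.IH)
      show "\<forall>i<m'. \<sigma> ! i = odd (v div 2 div 2 ^ i)"
      proof (intro allI impI)
        fix i assume "i < m'"
        then have "(b # \<sigma>) ! Suc i = odd (v div 2 ^ Suc i)" using Cons.prems(3) Suc by blast
        then show "\<sigma> ! i = odd (v div 2 div 2 ^ i)" by (simp add: div_mult2_eq)
      qed
    qed (use Cons.prems Suc in auto)
    moreover have "b = odd v" using Cons.prems(3) Suc by auto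
    moreover have "Suc (str_code (b # \<sigma>)) = of_bool b + 2 * Suc (str_code \<sigma>)" by simp
    moreover have "(of_bool c + 2 * w) mod (2 * M) = of_bool c + 2 * (w mod M)" for c and w M :: nat
      by (cases c) (simp_all add: mod_mult2_eq)
    ultimately have "Suc (str_code (b # \<sigma>)) mod 2 ^ m = of_bool (odd v) + 2 * (v div 2)"
      unfolding Suc power_Suc by (simp only:)
    then show ?thesis by (simp add: mod2_eq_if flip: mod_2_eq_odd)
  qed
qed

section \<open>Kraft's inequality\<close>

lemma card_extensions:
  assumes "length \<sigma> \<le> L"
  shows "finite {\<rho>::bool list. length \<rho> = L \<and> prefix \<sigma> \<rho>}"
    "card {\<rho>::bool list. length \<rho> = L \<and> prefix \<sigma> \<rho>} = 2 ^ (L - length \<sigma>)"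
proof -
  have eq: "{\<rho>. length \<rho> = L \<and> prefix \<sigma> \<rho>} = (@) \<sigma> ` {\<tau>. length \<tau> = L - length \<sigma>}"
    using assms by (auto simp: prefix_def)
  have "{\<tau>::bool list. length \<tau> = n} = {\<tau>. set \<tau> \<subseteq> UNIV \<and> length \<tau> = n}" for n by auto
  then have fin: "finite {\<tau>::bool list. length \<tau> = n}" "card {\<tau>::bool list. length \<tau> = n} = 2 ^ n" for n
    using finite_lists_length_eq[of "UNIV :: bool set" n] card_lists_length_eq[of "UNIV :: bool set" n]
    by (simp_all add: card_UNIV_bool)
  show "finite {\<rho>. length \<rho> = L \<and> prefix \<sigma> \<rho>}" unfolding eq using fin(1) by simp
  show "card {\<rho>. length \<rho> = L \<and> prefix \<sigma> \<rho>} = 2 ^ (L - length \<sigma>)"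
    unfolding eq by (subst card_image) (auto simp: inj_on_def fin(2))
qed

text \<open>Prefix-freeness makes the sets of extensions to length \<open>L\<close> disjoint, and
  there are only \<open>2 ^ L\<close> strings of that length.\<close>

lemma kraft:
  fixes F :: "bool list set"
  assumes "finite F" "\<And>\<sigma> \<tau>. \<sigma> \<in> F \<Longrightarrow> \<tau> \<in> F \<Longrightarrow> prefix \<sigma> \<tau> \<Longrightarrow> \<sigma> = \<tau>"
    "\<And>\<sigma>. \<sigma> \<in> F \<Longrightarrow> length \<sigma> \<le> L"
  shows "(\<Sum>\<sigma>\<in>F. 2 ^ (L - length \<sigma>)) \<le> (2::nat) ^ L"
proof -
  define E where "E \<sigma> = {\<rho>::bool list. length \<rho> = L \<and> prefix \<sigma> \<rho>}" for \<sigma>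
  have "(\<Sum>\<sigma>\<in>F. 2 ^ (L - length \<sigma>)) = (\<Sum>\<sigma>\<in>F. card (E \<sigma>))"
    using assms(3) by (intro sum.cong) (simp_all add: card_extensions E_def)
  also have "\<dots> = card (\<Union>\<sigma>\<in>F. E \<sigma>)"
  proof (rule card_UN_disjoint[symmetric])
    show "\<forall>i\<in>F. \<forall>j\<in>F. i \<noteq> j \<longrightarrow> E i \<inter> E j = {}"
    proof (intro ballI impI equals0I)
      fix \<sigma> \<tau> \<rho> assume *: "\<sigma> \<in> F" "\<tau> \<in> F" "\<sigma> \<noteq> \<tau>" "\<rho> \<in> E \<sigma> \<inter> E \<tau>"
      then have "prefix \<sigma> \<rho>" "prefix \<tau> \<rho>" by (auto simp: E_def)
      then have "prefix \<sigma> \<tau> \<or> prefix \<tau> \<sigma>" by (metis prefix_same_cases)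
      with *(1-3) assms(2)[of \<sigma> \<tau>] assms(2)[of \<tau> \<sigma>] show False by auto
    qed
  qed (use assms card_extensions in \<open>auto simp: E_def\<close>)
  also have "\<dots> \<le> card (E [])"
    by (rule card_mono) (auto simp: E_def intro: card_extensions(1)[of "[]", simplified])
  also have "\<dots> = 2 ^ L" using card_extensions(2)[of "[]" L] by (simp add: E_def)
  finally show ?thesis .
qed

section \<open>Combinatorics of avoidance\<close>

text \<open>
  Think of \<open>s\<close> as listing the bad elements of \<open>{..<N}\<close> in the order of their discovery. \<open>Q\<close> answers
  the question which index of the tuple \<open>T\<close> does not carry the bad element found first, and \<open>s\<close> is
  consistent with \<open>Q\<close> if none of these answers is wrong for \<open>s\<close>.
\<close>

definition consistent :: "(nat \<Rightarrow> nat) \<Rightarrow> nat \<Rightarrow> nat \<Rightarrow> nat \<Rightarrow> nat \<Rightarrow> bool" where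
  "consistent Q N a c s \<longleftrightarrow> (\<forall>T<N ^ a. \<forall>k<c. \<forall>i<a.
     dig N T i = dig N s k \<and> (\<forall>i'<i. dig N T i' \<noteq> dig N s k) \<and>
     (\<forall>k'<k. \<forall>i'<a. dig N T i' \<noteq> dig N s k') \<longrightarrow> Q T \<noteq> i)"

text \<open>The unknown true order of discovery is one of the sequences quantified over. All
  quantifiers are bounded, so the test is decidable from \<open>Q\<close>.\<close>

definition certified :: "(nat \<Rightarrow> nat) \<Rightarrow> nat \<Rightarrow> nat \<Rightarrow> nat \<Rightarrow> bool" where
  "certified Q N a j \<longleftrightarrow> (\<forall>c\<le>N div a. \<forall>s<N ^ c. consistent Q N a c s \<longrightarrow> (\<forall>k<c. dig N s k \<noteq> j))"

text \<open>
  If \<open>W\<close> contains none of the first \<open>k\<close> elements of any consistent sequence, then an element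
  of \<open>W\<close> which \<open>Q\<close> selects from some \<open>a\<close>-subset of \<open>W\<close> is not the element number \<open>k\<close> either. The
  elements never selected are fewer than \<open>a\<close>, since otherwise \<open>a\<close> of them would form such a subset.
\<close>

lemma consistent_avoiding_set:
  assumes a: "0 < a" and Q: "\<And>T. T < N ^ a \<Longrightarrow> Q T < a"
  shows "\<exists>W\<subseteq>{..<N}. N \<le> card W + k * (a - 1) \<and>
    (\<forall>c s. consistent Q N a c s \<longrightarrow> (\<forall>k'<c. k' < k \<longrightarrow> dig N s k' \<notin> W))"
proof (induction k)
  case 0
  show ?case by (rule exI[of _ "{..<N}"]) auto
next
  case (Suc k)
  then obtain W where W: "W \<subseteq> {..<N}" "N \<le> card W + k * (a - 1)"
    "\<And>c s k'. consistent Q N a c s \<Longrightarrow> k' < c \<Longrightarrow> k' < k \<Longrightarrow> dig N s k' \<notin> W" by blast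
  have finW: "finite W" using W(1) finite_subset by blast
  define S where "S = {T. T < N ^ a \<and> (\<forall>i<a. dig N T i \<in> W) \<and> inj_on (dig N T) {..<a}}"
  define W' where "W' = (\<lambda>T. dig N T (Q T)) ` S"
  have W'W: "W' \<subseteq> W" using Q by (auto simp: W'_def S_def)
  have "card (W - W') < a"
  proof (rule ccontr)
    assume "\<not> card (W - W') < a"
    then obtain B where B: "B \<subseteq> W - W'" "card B = a" "finite B"
      by (meson not_less obtain_subset_with_card_n)
    then obtain t where t: "bij_betw t {0..<a} B" using ex_bij_betw_nat_finite by blast
    have tB: "t i \<in> B" if "i < a" for i using t that by (auto simp: bij_betw_def)
    then have "\<forall>i<a. t i < N" using B(1) W(1) by auto
    from dig_encode[OF this] obtain T where T: "T < N ^ a" "\<forall>i<a. dig N T i = t i" by blast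
    have "inj_on (dig N T) {..<a}"
      using t T(2) by (auto simp: bij_betw_def inj_on_def)
    then have "T \<in> S" using T tB B(1) by (auto simp: S_def)
    then have "dig N T (Q T) \<in> W'" by (auto simp: W'_def)
    moreover have "dig N T (Q T) \<in> W - W'" using T tB B(1) Q[OF T(1)] by auto
    ultimately show False by simp
  qed
  moreover have "card (W - W') = card W - card W'" using W'W finW by (simp add: card_Diff_subset finite_subset)
  ultimately have "card W \<le> card W' + (a - 1)" by linarith
  then have "N \<le> card W' + Suc k * (a - 1)" using W(2) by simp
  moreover have "dig N s k' \<notin> W'" if s: "consistent Q N a c s" "k' < c" "k' < Suc k" for c s k'
  proof
    assume mem: "dig N s k' \<in> W'"
    then have "k' = k" using W(3)[OF s(1,2)] s(3) W'W by (auto simp: less_Suc_eq)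
    from mem obtain T where T: "T \<in> S" "dig N T (Q T) = dig N s k'" by (auto simp: W'_def)
    then have TN: "T < N ^ a" "\<forall>i<a. dig N T i \<in> W" "inj_on (dig N T) {..<a}" by (auto simp: S_def)
    \<comment> \<open>Distinct entries make \<open>Q T\<close> the first index carrying this
      element, as the premise in \<open>consistent\<close> demands.\<close>
    have "\<forall>i'<Q T. dig N T i' \<noteq> dig N s k'"
      using TN(3) Q[OF TN(1)] T(2) by (metis inj_on_def lessThan_iff less_trans nat_neq_iff)
    moreover have "\<forall>k''<k'. \<forall>i'<a. dig N T i' \<noteq> dig N s k''"
      using TN(2) W(3)[OF s(1)] s(2) \<open>k' = k\<close> by (metis less_trans)
    ultimately show False
      using s(1)[unfolded consistent_def, rule_format, OF TN(1) s(2) Q[OF TN(1)]] T(2) by blast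
  qed
  ultimately show ?case using W'W W(1) by (intro exI[of _ W']) blast
qed

text \<open>Each of the \<open>N div a\<close> rounds loses at most \<open>a - 1\<close> elements,
  in total fewer than \<open>N\<close>; whatever remains lies in no consistent sequence of
  admissible length.\<close>

lemma certified_exists:
  assumes a: "0 < a" and N: "0 < N" and Q: "\<And>T. T < N ^ a \<Longrightarrow> Q T < a"
  shows "\<exists>j<N. certified Q N a j"
proof -
  obtain W where W: "W \<subseteq> {..<N}" "N \<le> card W + (N div a) * (a - 1)"
    "\<And>c s k'. consistent Q N a c s \<Longrightarrow> k' < c \<Longrightarrow> k' < N div a \<Longrightarrow> dig N s k' \<notin> W"
    using consistent_avoiding_set[of a N Q "N div a"] a Q by blast
  have "(N div a) * (a - 1) < N"
  proof (cases "N div a = 0")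
    case True
    then show ?thesis using N by (simp only: mult_0)
  next
    case False
    then have "(N div a) * (a - 1) < (N div a) * a" using a by (intro mult_strict_left_mono) auto
    also have "\<dots> \<le> N" by simp
    finally show ?thesis .
  qed
  with W(2) have "W \<noteq> {}" by (metis add_0 card.empty not_le)
  then obtain j where "j \<in> W" by blast
  then have "certified Q N a j" unfolding certified_def using W(3)
    by (metis less_le_trans)
  with \<open>j \<in> W\<close> W(1) show ?thesis by blast
qed

text \<open>
  Here \<open>r\<close> is the time of discovery, and the last assumption says that \<open>Q\<close> never returns the
  index of the element of \<open>T\<close> that is discovered first.
\<close>

lemma certified_not_mem:
  fixes S :: "nat set" and r :: "nat \<Rightarrow> nat"
  assumes S: "S \<subseteq> {..<N}" "card S * a \<le> N" "0 < a" and r: "inj_on r S"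
    and Q: "\<And>T i z. T < N ^ a \<Longrightarrow> i < a \<Longrightarrow> z \<in> S \<Longrightarrow> dig N T i = z \<Longrightarrow> (\<And>i'. i' < i \<Longrightarrow> dig N T i' \<noteq> z) \<Longrightarrow>
      (\<And>i'. i' < a \<Longrightarrow> dig N T i' \<in> S \<Longrightarrow> r z \<le> r (dig N T i')) \<Longrightarrow> Q T \<noteq> i"
    and j: "certified Q N a j"
  shows "j \<notin> S"
proof
  assume "j \<in> S"
  have fin: "finite S" using S(1) finite_subset by blast
  \<comment> \<open>The actual order of discovery. Its consistency with \<open>Q\<close> is what
    rules out \<open>j\<close>.\<close>
  define L where "L = map (the_inv_into S r) (sorted_list_of_set (r ` S))"
  define c where "c = card S"
  have len: "length L = c" by (simp add: L_def c_def card_image[OF r])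
  have rs: "sorted_list_of_set (r ` S) ! k \<in> r ` S" if "k < c" for k
    using nth_mem[of k "sorted_list_of_set (r ` S)"] fin that by (simp add: c_def card_image[OF r])
  have LS: "L ! k \<in> S" and rL: "r (L ! k) = sorted_list_of_set (r ` S) ! k" if "k < c" for k
    using rs[OF that] that r
    by (auto simp: L_def c_def card_image the_inv_into_into[OF r] the_inv_into_f_f[OF r])
  have setL: "set L = S"
    using fin r by (auto simp: L_def the_inv_into_f_f image_image)
  have sorted: "r (L ! k) \<le> r (L ! k')" if "k \<le> k'" "k' < c" for k k'
    using that rL sorted_sorted_list_of_set[of "r ` S"]
    by (simp add: sorted_iff_nth_mono c_def card_image[OF r])
  have "\<forall>k<c. L ! k < N" using LS S(1) by auto
  from dig_encode[OF this] obtain s where s: "s < N ^ c" "\<And>k. k < c \<Longrightarrow> dig N s k = L ! k" by blast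
  have "consistent Q N a c s"
    unfolding consistent_def
  proof (intro allI impI, elim conjE)
    fix T k i
    assume *: "T < N ^ a" "k < c" "i < a" "dig N T i = dig N s k" "\<forall>i'<i. dig N T i' \<noteq> dig N s k"
      "\<forall>k'<k. \<forall>i'<a. dig N T i' \<noteq> dig N s k'"
    show "Q T \<noteq> i"
    proof (rule Q[OF *(1,3) LS[OF *(2)]])
      fix i' assume i': "i' < a" "dig N T i' \<in> S"
      then obtain k' where k': "k' < c" "L ! k' = dig N T i'" using setL len by (metis in_set_conv_nth)
      then have "\<not> k' < k" using *(6) i'(1) s(2) by metis
      then show "r (L ! k) \<le> r (dig N T i')" using sorted[of k k'] k' by simp
    qed (use * s(2) in auto)
  qed
  moreover have "c \<le> N div a" using S(2,3) by (simp add: c_def less_eq_div_iff_mult_less_eq)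
  moreover obtain k where "k < c" "L ! k = j" using setL len \<open>j \<in> S\<close> by (metis in_set_conv_nth)
  ultimately show False using j s unfolding certified_def by metis
qed

lemma decidable_in_certified:
  assumes q: "\<And>k f. recursive_in A k f \<Longrightarrow> recursive_in A k (\<lambda>xs. q (f xs))"
    and "recursive_in A k Q0" "recursive_in A k Q1" "recursive_in A k N" "recursive_in A k a" "recursive_in A k j"
  shows "decidable_in A k (\<lambda>xs. certified (\<lambda>T. q (pair (Q0 xs) (pair (Q1 xs) T))) (N xs) (a xs) (j xs))"
proof -
  have "decidable_in A 5 (\<lambda>xs. certified (\<lambda>T. q (pair (xs ! 0) (pair (xs ! 1) T))) (xs ! 2) (xs ! 3) (xs ! 4))"
    unfolding certified_def consistent_def by (intro q rec_intros; simp)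
  then show ?thesis
    using recursive_in_compose[of A "[Q0, Q1, N, a, j]"
      "\<lambda>xs. of_bool (certified (\<lambda>T. q (pair (xs ! 0) (pair (xs ! 1) T))) (xs ! 2) (xs ! 3) (xs ! 4))" k] assms
    by (auto simp: decidable_in_def numeral_eq_Suc)
qed

section \<open>Strings of small weight\<close>

text \<open>
  \<open>h s x\<close> is \<open>Suc y\<close> if the machine, run for \<open>s\<close> steps on the string with code \<open>x\<close>, outputs the
  string with code \<open>y\<close>. A string of length \<open>m\<close> is represented by the number \<open>v < 2 ^ m\<close> with these
  binary digits, least significant digit first. Then \<open>h s x = Suc y\<close> extends it iff
  \<open>2 ^ m \<le> h s x\<close> and \<open>h s x mod 2 ^ m = v\<close>.
\<close>

locale halting_stages =
  fixes h :: "nat \<Rightarrow> nat \<Rightarrow> nat" and d :: "nat \<Rightarrow> nat"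
  assumes h_mono: "h s x = Suc y \<Longrightarrow> s \<le> t \<Longrightarrow> h t x = Suc y"
    and kraft_h: "(\<Sum>x<s. if h s x \<noteq> 0 then 2 ^ (s - code_length x) else 0) \<le> (2::nat) ^ s"
    and d_pos: "0 < d n"
    and recursive_h: "recursive_in A 2 (\<lambda>xs. h (xs ! 0) (xs ! 1))"
    and recursive_d: "recursive_in A 1 (\<lambda>xs. d (xs ! 0))"
begin

text \<open>The measure of the programs below \<open>s\<close> whose output at stage
  \<open>s\<close> extends the node, multiplied by \<open>2 ^ s\<close> to stay in the natural
  numbers. The subtraction never truncates, as \<open>code_length x \<le> x < s\<close>.\<close>

definition weight :: "nat \<Rightarrow> nat \<Rightarrow> nat \<Rightarrow> nat" where
  "weight s m v = (\<Sum>x<s. if 2 ^ m \<le> h s x \<and> h s x mod 2 ^ m = v then 2 ^ (s - code_length x) else 0)"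

lemma h_stable: "h s x \<noteq> 0 \<Longrightarrow> s \<le> t \<Longrightarrow> h t x = h s x"
  using h_mono by (metis not0_implies_Suc)

lemma weight_mono:
  assumes "s \<le> t"
  shows "weight s m v * 2 ^ (t - s) \<le> weight t m v"
proof -
  have "weight s m v * 2 ^ (t - s) =
      (\<Sum>x<s. if 2 ^ m \<le> h s x \<and> h s x mod 2 ^ m = v then 2 ^ (t - code_length x) else 0)"
    unfolding weight_def sum_distrib_right
  proof (rule sum.cong[OF refl])
    fix x assume "x \<in> {..<s}"
    then have "s - code_length x + (t - s) = t - code_length x"
      using assms code_length_le[of x] by simp
    then show "(if 2 ^ m \<le> h s x \<and> h s x mod 2 ^ m = v then 2 ^ (s - code_length x) else 0) * 2 ^ (t - s) =
      (if 2 ^ m \<le> h s x \<and> h s x mod 2 ^ m = v then (2::nat) ^ (t - code_length x) else 0)"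
      by (simp flip: power_add)
  qed
  also have "\<dots> \<le> (\<Sum>x<s. if 2 ^ m \<le> h t x \<and> h t x mod 2 ^ m = v then 2 ^ (t - code_length x) else 0)"
  proof (rule sum_mono)
    fix x
    have "h t x = h s x" if "2 ^ m \<le> h s x"
      using that assms less_le_trans[OF zero_less_power[of "2::nat" m] that] by (intro h_stable) auto
    then show "(if 2 ^ m \<le> h s x \<and> h s x mod 2 ^ m = v then 2 ^ (t - code_length x) else 0)
      \<le> (if 2 ^ m \<le> h t x \<and> h t x mod 2 ^ m = v then (2::nat) ^ (t - code_length x) else 0)" by auto
  qed
  also have "\<dots> \<le> weight t m v"
    unfolding weight_def using assms by (intro sum_mono2) auto
  finally show ?thesis .
qed

text \<open>The residue modulo \<open>2 ^ (m + r)\<close> lets an output extend at most one child,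
  and what extends a child extends the parent.\<close>

lemma weight_sum:
  assumes J: "finite J" and v: "v < 2 ^ m"
  shows "(\<Sum>j\<in>J. weight s (m + r) (v + 2 ^ m * j)) \<le> weight s m v"
proof -
  define E where "E m v x \<longleftrightarrow> 2 ^ m \<le> h s x \<and> h s x mod 2 ^ m = v" for m v x
  have "(\<Sum>j\<in>J. weight s (m + r) (v + 2 ^ m * j)) =
      (\<Sum>x<s. \<Sum>j\<in>J. if E (m + r) (v + 2 ^ m * j) x then 2 ^ (s - code_length x) else 0)"
    unfolding weight_def E_def by (rule sum.swap)
  also have "\<dots> \<le> (\<Sum>x<s. if E m v x then 2 ^ (s - code_length x) else 0)"
  proof (rule sum_mono)
    fix x
    let ?w = "2 ^ (s - code_length x) :: nat"
    show "(\<Sum>j\<in>J. if E (m + r) (v + 2 ^ m * j) x then ?w else 0) \<le> (if E m v x then ?w else 0)"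
    proof (cases "\<exists>j0\<in>J. E (m + r) (v + 2 ^ m * j0) x")
      case True
      then obtain j0 where j0: "j0 \<in> J" "2 ^ (m + r) \<le> h s x" "h s x mod 2 ^ (m + r) = v + 2 ^ m * j0"
        unfolding E_def by auto
      have "(2::nat) ^ m \<le> 2 ^ (m + r)" by (intro power_increasing) auto
      moreover have "h s x mod 2 ^ m = h s x mod 2 ^ (m + r) mod 2 ^ m"
        by (simp add: mod_mod_cancel le_imp_power_dvd)
      ultimately have "E m v x" using j0(2,3) v unfolding E_def by (intro conjI) (linarith, simp)
      moreover have "E (m + r) (v + 2 ^ m * j) x \<longleftrightarrow> j = j0" for j
        using j0 unfolding E_def by auto
      ultimately show ?thesis using J j0(1) by simp
    next
      case False
      then show ?thesis by simp
    qed
  qed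
  also have "\<dots> = weight s m v" by (simp add: weight_def E_def)
  finally show ?thesis .
qed

section \<open>Heavy and light nodes\<close>

definition deficiency :: "nat \<Rightarrow> nat" where
  "deficiency n = (\<Sum>i<n. d i)"

text \<open>Divided by \<open>2 ^ (s + n\<^sup>2)\<close>, this says that the measure found by stage
  \<open>s\<close> exceeds the threshold of the overview, with \<open>deficiency\<close> in the role
  of \<open>D\<close>.\<close>

definition heavy :: "nat \<Rightarrow> nat \<Rightarrow> nat \<Rightarrow> bool" where
  "heavy s n v \<longleftrightarrow> 2 ^ (s + deficiency n) < 2 ^ n\<^sup>2 * weight s (n\<^sup>2) v"

definition light :: "nat \<Rightarrow> nat \<Rightarrow> bool" where
  "light n v \<longleftrightarrow> v < 2 ^ n\<^sup>2 \<and> (\<forall>s. \<not> heavy s n v)"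

text \<open>Later letters are more significant digits, so the \<open>2 * n + 1\<close> new ones go
  above the \<open>n\<^sup>2\<close> digits of \<open>v\<close>.\<close>

definition child :: "nat \<Rightarrow> nat \<Rightarrow> nat \<Rightarrow> nat" where
  "child n v j = v + 2 ^ n\<^sup>2 * j"

abbreviation width :: "nat \<Rightarrow> nat" where
  "width n \<equiv> 2 ^ (2 * n + 1)"

lemma heavy_mono:
  assumes "heavy s n v" "s \<le> t"
  shows "heavy t n v"
proof -
  have "(2::nat) ^ (t + deficiency n) = 2 ^ (s + deficiency n) * 2 ^ (t - s)"
    using assms(2) by (simp flip: power_add)
  also have "\<dots> < 2 ^ n\<^sup>2 * weight s (n\<^sup>2) v * 2 ^ (t - s)"
    using assms(1) by (simp add: heavy_def)
  also have "\<dots> \<le> 2 ^ n\<^sup>2 * weight t (n\<^sup>2) v"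
    using weight_mono[OF assms(2)] by (simp add: mult.assoc)
  finally show ?thesis by (simp add: heavy_def)
qed

text \<open>At the root, lightness is Kraft's inequality for the whole machine.\<close>

lemma light_0: "light 0 0"
proof -
  have "weight s 0 0 = (\<Sum>x<s. if h s x \<noteq> 0 then 2 ^ (s - code_length x) else 0)" for s
    unfolding weight_def by (intro sum.cong) (auto simp: Suc_le_eq)
  then show ?thesis using kraft_h by (simp add: light_def heavy_def deficiency_def not_less)
qed

lemma square_Suc: "(Suc n)\<^sup>2 = n\<^sup>2 + (2 * n + 1)"
  by (simp add: power2_eq_square)

lemma child_less:
  assumes "v < 2 ^ n\<^sup>2" "j < width n"
  shows "child n v j < 2 ^ (Suc n)\<^sup>2"
proof -
  have "child n v j < 2 ^ n\<^sup>2 * Suc j" using assms(1) by (simp add: child_def)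
  also have "\<dots> \<le> 2 ^ n\<^sup>2 * width n" using assms(2) by (intro mult_left_mono) auto
  also have "\<dots> = 2 ^ (Suc n)\<^sup>2" by (simp add: square_Suc power_add)
  finally show ?thesis .
qed

text \<open>At a common stage every child in \<open>J\<close> carries at least
  \<open>2 ^ (D (n + 1) - (n + 1)\<^sup>2)\<close> and their parent at most
  \<open>2 ^ (D n - n\<^sup>2)\<close>, in the notation of the overview. The quotient of these
  bounds is \<open>width n / 2 ^ d n\<close>.\<close>

lemma card_heavy_children:
  assumes v: "light n v" and J: "finite J" "\<And>j. j \<in> J \<Longrightarrow> \<exists>s. heavy s (Suc n) (child n v j)"
  shows "card J * 2 ^ d n \<le> width n"
proof -
  obtain g where g: "\<And>j. j \<in> J \<Longrightarrow> heavy (g j) (Suc n) (child n v j)" using J(2) by metis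
  define s where "s = Max (insert 0 (g ` J))"
  have heavy: "heavy s (Suc n) (child n v j)" if "j \<in> J" for j
    using g[OF that] by (rule heavy_mono) (use J that in \<open>auto simp: s_def\<close>)
  have v': "v < 2 ^ n\<^sup>2" "\<not> heavy s n v" using v by (auto simp: light_def)
  have "card J * 2 ^ (s + deficiency (Suc n)) = (\<Sum>j\<in>J. 2 ^ (s + deficiency (Suc n)))" by simp
  also have "\<dots> \<le> (\<Sum>j\<in>J. 2 ^ (Suc n)\<^sup>2 * weight s (n\<^sup>2 + (2 * n + 1)) (v + 2 ^ n\<^sup>2 * j))"
    using heavy unfolding heavy_def child_def square_Suc by (intro sum_mono less_imp_le)
  also have "\<dots> = 2 ^ (Suc n)\<^sup>2 * (\<Sum>j\<in>J. weight s (n\<^sup>2 + (2 * n + 1)) (v + 2 ^ n\<^sup>2 * j))"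
    by (simp add: sum_distrib_left)
  also have "\<dots> \<le> 2 ^ (Suc n)\<^sup>2 * weight s (n\<^sup>2) v"
    by (intro mult_left_mono weight_sum J v') simp
  also have "\<dots> = width n * (2 ^ n\<^sup>2 * weight s (n\<^sup>2) v)"
    by (simp add: square_Suc power_add mult_ac)
  also have "\<dots> \<le> width n * 2 ^ (s + deficiency n)"
    using v'(2) by (intro mult_left_mono) (auto simp: heavy_def)
  finally have "(card J * 2 ^ d n) * 2 ^ (s + deficiency n) \<le> width n * 2 ^ (s + deficiency n)"
    by (simp add: deficiency_def power_add mult_ac)
  then show ?thesis by simp
qed

text \<open>By \<open>0 < d n\<close> at most half of the children are heavy. This is pure
  existence, which suffices for the starting node of the path.\<close>

lemma light_exists: "\<exists>v. light n v"
proof (induction n)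
  case 0
  then show ?case using light_0 by blast
next
  case (Suc n)
  then obtain v where v: "light n v" by blast
  define J where "J = {j\<in>{..<width n}. \<exists>s. heavy s (Suc n) (child n v j)}"
  have "card J * 2 ^ d n \<le> width n" by (rule card_heavy_children[OF v]) (auto simp: J_def)
  moreover have "card J \<noteq> width n"
  proof
    assume "card J = width n"
    with calculation have "(2::nat) ^ d n \<le> 1" by simp
    moreover have "(2::nat) ^ 1 \<le> 2 ^ d n" using d_pos[of n] by (intro power_increasing) auto
    ultimately show False by simp
  qed
  ultimately have "J \<noteq> {..<width n}" by auto
  then obtain j where j: "j < width n" "j \<notin> J" unfolding J_def by blast
  then have "light (Suc n) (child n v j)"
    using v child_less[of v n j] by (auto simp: light_def J_def)
  then show ?case by blast
qed

subsection \<open>Queries\<close>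

text \<open>
  \<open>p\<close> ranges over all pairs of a stage and a child, so that the children of a node which
  become heavy are discovered one at a time.
\<close>

definition discovers :: "nat \<Rightarrow> nat \<Rightarrow> nat \<Rightarrow> bool" where
  "discovers n v p \<longleftrightarrow> heavy (p div width n) (Suc n) (child n v (p mod width n))"

text \<open>\<open>x\<close> is read as \<open>pair n (pair v T)\<close>: level, node and tuple of
  children.\<close>

definition hit :: "nat \<Rightarrow> nat \<Rightarrow> bool" where
  "hit p x \<longleftrightarrow> discovers (left x) (left (right x)) p \<and>
     (\<exists>i<2 ^ d (left x). dig (width (left x)) (right (right x)) i = p mod width (left x))"

text \<open>The first disjunct makes the search total; if \<open>hit p x\<close> holds, the result
  is a genuine index into the tuple.\<close>

definition index_of :: "nat \<Rightarrow> nat \<Rightarrow> nat" where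
  "index_of p x = (LEAST i. 2 ^ d (left x) \<le> i \<or>
     dig (width (left x)) (right (right x)) i = p mod width (left x))"

definition first_heavy :: "nat \<Rightarrow> nat option" where
  "first_heavy x = (if \<exists>p. hit p x then Some (index_of (LEAST p. hit p x) x) else None)"

lemma light_child:
  assumes v: "light n v" and avoid: "\<And>T. first_heavy (pair n (pair v T)) \<noteq> Some (Q T)"
    and j: "j < width n" "certified Q (width n) (2 ^ d n) j"
  shows "light (Suc n) (child n v j)"
proof -
  define S where "S = {j\<in>{..<width n}. \<exists>s. heavy s (Suc n) (child n v j)}"
  \<comment> \<open>The time of discovery of child \<open>z\<close>. Its residue modulo
    \<open>width n\<close> is \<open>z\<close> itself, so different children have different
    times.\<close>
  define r where "r z = (LEAST p. p mod width n = z \<and> discovers n v p)" for z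
  have r: "r z mod width n = z \<and> discovers n v (r z)" if "z \<in> S" for z
  proof -
    from that obtain s where "z < width n" "heavy s (Suc n) (child n v z)" by (auto simp: S_def)
    then have "(s * width n + z) mod width n = z \<and> discovers n v (s * width n + z)"
      by (simp add: discovers_def)
    then show ?thesis unfolding r_def by (rule LeastI)
  qed
  have r_le: "r z \<le> p" if "p mod width n = z" "discovers n v p" for z p
    unfolding r_def using that by (intro Least_le) simp
  have "j \<notin> S"
  proof (rule certified_not_mem[OF _ _ _ _ _ j(2)])
    show "card S * 2 ^ d n \<le> width n" by (rule card_heavy_children[OF v]) (auto simp: S_def)
    show "inj_on r S" using r by (metis inj_onI)
    fix T i z
    assume T: "i < 2 ^ d n" "z \<in> S" "dig (width n) T i = z" "\<And>i'. i' < i \<Longrightarrow> dig (width n) T i' \<noteq> z"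
      "\<And>i'. i' < 2 ^ d n \<Longrightarrow> dig (width n) T i' \<in> S \<Longrightarrow> r z \<le> r (dig (width n) T i')"
    let ?x = "pair n (pair v T)"
    have hit: "hit (r z) ?x" using r[OF T(2)] T(1,3) by (auto simp: hit_def)
    have "(LEAST p. hit p ?x) = r z"
    proof (rule Least_equality)
      fix p assume "hit p ?x"
      then obtain i' where i': "discovers n v p" "i' < 2 ^ d n" "dig (width n) T i' = p mod width n"
        by (auto simp: hit_def)
      then have "p mod width n \<in> S" by (auto simp: S_def discovers_def)
      then have "r z \<le> r (p mod width n)" using T(5)[of i'] i' by simp
      also have "\<dots> \<le> p" using r_le i'(1) by simp
      finally show "r z \<le> p" .
    qed (rule hit)
    moreover have "index_of (r z) ?x = i"
      unfolding index_of_def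
    proof (rule Least_equality)
      show "2 ^ d (left ?x) \<le> i \<or> dig (width (left ?x)) (right (right ?x)) i = r z mod width (left ?x)"
        using r[OF T(2)] T(3) by simp
      show "i \<le> i'" if "2 ^ d (left ?x) \<le> i' \<or>
          dig (width (left ?x)) (right (right ?x)) i' = r z mod width (left ?x)" for i'
        using that r[OF T(2)] T(1,4) by (auto intro: leI)
    qed
    ultimately have "first_heavy ?x = Some i" using hit by (auto simp: first_heavy_def)
    then show "Q T \<noteq> i" using avoid[of T] by auto
  qed (auto simp: S_def)
  then show ?thesis using v j child_less[of v n j] by (auto simp: S_def light_def)
qed

lemma recursive_in_h: "recursive_in A k f \<Longrightarrow> recursive_in A k g \<Longrightarrow> recursive_in A k (\<lambda>xs. h (f xs) (g xs))"
  by (rule recursive_in_compose2[OF recursive_h])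

lemma recursive_in_d: "recursive_in A k f \<Longrightarrow> recursive_in A k (\<lambda>xs. d (f xs))"
  by (rule recursive_in_compose1[OF recursive_d])

lemma recursive_in_weight:
  assumes "recursive_in A k f" "recursive_in A k g" "recursive_in A k l"
  shows "recursive_in A k (\<lambda>xs. weight (f xs) (g xs) (l xs))"
proof (rule recursive_in_compose3[OF _ assms])
  show "recursive_in A 3 (\<lambda>xs. weight (xs ! 0) (xs ! 1) (xs ! 2))"
    unfolding weight_def by (intro rec_intros recursive_in_h; simp)
qed

lemma recursive_in_deficiency:
  assumes "recursive_in A k f"
  shows "recursive_in A k (\<lambda>xs. deficiency (f xs))"
proof (rule recursive_in_compose1[OF _ assms])
  show "recursive_in A 1 (\<lambda>xs. deficiency (xs ! 0))"
    unfolding deficiency_def by (intro rec_intros recursive_in_d; simp)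
qed

lemma partial_recursive_first_heavy: "partial_recursive first_heavy"
  unfolding first_heavy_def
proof (rule partial_recursive_search)
  show "decidable_in Map.empty 2 (\<lambda>ys. hit (ys ! 0) (ys ! 1))"
    unfolding hit_def discovers_def heavy_def child_def
    by (intro rec_intros recursive_in_d recursive_in_weight recursive_in_deficiency; simp)
  show "recursive_in Map.empty 2 (\<lambda>ys. index_of (ys ! 0) (ys ! 1))"
    unfolding index_of_def
  proof (rule recursive_in_Least)
    show "\<exists>i. 2 ^ d (left (ys ! 1)) \<le> i \<or> dig (width (left (ys ! 1))) (right (right (ys ! 1))) i =
        ys ! 0 mod width (left (ys ! 1))" for ys
      by (rule exI[of _ "2 ^ d (left (ys ! 1))"]) simp
  qed (intro rec_intros recursive_in_d; simp)+
qed

subsection \<open>The path\<close>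

text \<open>The alternative \<open>width n \<le> j\<close> makes the search total at nodes where the
  bound on \<open>q\<close> may fail; \<open>light_path\<close> shows that it is never chosen on the
  path.\<close>

definition next_child :: "(nat \<Rightarrow> nat) \<Rightarrow> nat \<Rightarrow> nat \<Rightarrow> nat" where
  "next_child q n v =
     (LEAST j. width n \<le> j \<or> certified (\<lambda>T. q (pair n (pair v T))) (width n) (2 ^ d n) j)"

definition path :: "(nat \<Rightarrow> nat) \<Rightarrow> nat \<Rightarrow> nat \<Rightarrow> nat \<Rightarrow> nat" where
  "path q n0 v0 k = rec_nat v0 (\<lambda>k v. child (n0 + k) v (next_child q (n0 + k) v)) k"

text \<open>After \<open>Suc i\<close> steps the node has \<open>(n0 + Suc i)\<^sup>2 > i\<close>
  digits, so digit \<open>i\<close> is settled by then.\<close>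

definition path_bit :: "(nat \<Rightarrow> nat) \<Rightarrow> nat \<Rightarrow> nat \<Rightarrow> nat \<Rightarrow> bool" where
  "path_bit q n0 v0 i \<longleftrightarrow> odd (path q n0 v0 (Suc i) div 2 ^ i)"

lemma recursive_in_path_bit:
  assumes q: "\<And>k f. recursive_in A k f \<Longrightarrow> recursive_in A k (\<lambda>xs. q (f xs))"
  shows "recursive_in A 1 (\<lambda>xs. of_bool (path_bit q n0 v0 (xs ! 0)))"
proof -
  have "recursive_in A 2 (\<lambda>xs. next_child q (xs ! 0) (xs ! 1))"
    unfolding next_child_def
  proof (rule recursive_in_Least)
    show "\<exists>j. width (xs ! 0) \<le> j \<or> certified (\<lambda>T. q (pair (xs ! 0) (pair (xs ! 1) T)))
        (width (xs ! 0)) (2 ^ d (xs ! 0)) j" for xs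
      by (rule exI[of _ "width (xs ! 0)"]) simp
  qed (intro rec_intros recursive_in_d decidable_in_certified q; simp)+
  note next_child = recursive_in_compose2[OF this]
  have "recursive_in A 1 (\<lambda>xs. path q n0 v0 (xs ! 0))"
    unfolding path_def child_def by (intro rec_intros next_child; simp)
  note path = recursive_in_compose1[OF this]
  then have "decidable_in A 1 (\<lambda>xs. path q n0 v0 (Suc (xs ! 0)) div 2 ^ (xs ! 0) mod 2 = 1)"
    by (intro rec_intros path; simp)
  then show ?thesis by (simp add: decidable_in_def path_bit_def odd_iff_mod_2_eq_one)
qed

lemma path_Suc: "path q n0 v0 (Suc k) = child (n0 + k) (path q n0 v0 k) (next_child q (n0 + k) (path q n0 v0 k))"
  by (simp add: path_def)

text \<open>The two properties of \<open>q\<close> act separately: the bound yields some certified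
  child, and avoidance of \<open>first_heavy\<close> makes every certified child light.\<close>

lemma light_path:
  assumes avoid: "\<And>x. first_heavy x \<noteq> Some (q x)"
    and bound: "\<And>n v T. n0 \<le> n \<Longrightarrow> v < 2 ^ n\<^sup>2 \<Longrightarrow> T < width n ^ 2 ^ d n \<Longrightarrow> q (pair n (pair v T)) < 2 ^ d n"
    and v0: "light n0 v0"
  shows "light (n0 + k) (path q n0 v0 k)"
proof (induction k)
  case 0
  then show ?case using v0 by (simp add: path_def)
next
  case (Suc k)
  let ?n = "n0 + k" and ?v = "path q n0 v0 k"
  let ?P = "\<lambda>j. width ?n \<le> j \<or> certified (\<lambda>T. q (pair ?n (pair ?v T))) (width ?n) (2 ^ d ?n) j"
  have "\<exists>j<width ?n. certified (\<lambda>T. q (pair ?n (pair ?v T))) (width ?n) (2 ^ d ?n) j"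
    by (rule certified_exists) (use Suc bound in \<open>auto simp: light_def\<close>)
  then obtain j where j: "j < width ?n" "?P j" by blast
  have "?P (next_child q ?n ?v)" unfolding next_child_def using j(2) by (rule LeastI)
  moreover have "next_child q ?n ?v \<le> j" unfolding next_child_def using j(2) by (rule Least_le)
  ultimately have "light (Suc ?n) (child ?n ?v (next_child q ?n ?v))"
    using j(1) avoid by (intro light_child[OF Suc]) auto
  then show ?case by (simp add: path_Suc)
qed

lemma path_mod:
  assumes "path q n0 v0 k < 2 ^ (n0 + k)\<^sup>2"
  shows "path q n0 v0 (k + l) mod 2 ^ (n0 + k)\<^sup>2 = path q n0 v0 k"
proof (induction l)
  case 0
  then show ?case using assms by simp
next
  case (Suc l)
  have "(n0 + k)\<^sup>2 \<le> (n0 + (k + l))\<^sup>2" by (intro power_mono) auto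
  then have "(2::nat) ^ (n0 + k)\<^sup>2 dvd 2 ^ (n0 + (k + l))\<^sup>2" by (rule le_imp_power_dvd)
  then have "2 ^ (n0 + k)\<^sup>2 dvd 2 ^ (n0 + (k + l))\<^sup>2 * next_child q (n0 + (k + l)) (path q n0 v0 (k + l))"
    by (rule dvd_mult2)
  then have "path q n0 v0 (k + Suc l) mod 2 ^ (n0 + k)\<^sup>2 = path q n0 v0 (k + l) mod 2 ^ (n0 + k)\<^sup>2"
    by (simp add: path_Suc child_def mod_add_eq dvd_imp_mod_0 flip: mod_add_right_eq)
  then show ?case using Suc by simp
qed

lemma odd_div_mod: "i < m \<Longrightarrow> odd (v mod 2 ^ m div 2 ^ i) \<longleftrightarrow> odd (v div 2 ^ i)" for v :: nat
  by (metis bit_iff_odd bit_take_bit_iff take_bit_eq_mod)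

text \<open>Both nodes involved are compared with the one after \<open>Suc i + k\<close> steps,
  which extends each of them.\<close>

lemma path_bit_iff:
  assumes "\<And>k. path q n0 v0 k < 2 ^ (n0 + k)\<^sup>2" "i < (n0 + k)\<^sup>2"
  shows "path_bit q n0 v0 i \<longleftrightarrow> odd (path q n0 v0 k div 2 ^ i)"
proof -
  have i: "i < (n0 + Suc i)\<^sup>2" by (simp add: power2_eq_square)
  have "odd (path q n0 v0 (Suc i + k) div 2 ^ i) \<longleftrightarrow> odd (path q n0 v0 (Suc i) div 2 ^ i)"
    using odd_div_mod[OF i, of "path q n0 v0 (Suc i + k)"] path_mod[OF assms(1), of "Suc i" k] by simp
  moreover have "odd (path q n0 v0 (Suc i + k) div 2 ^ i) \<longleftrightarrow> odd (path q n0 v0 k div 2 ^ i)"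
    using odd_div_mod[OF assms(2), of "path q n0 v0 (k + Suc i)"] path_mod[OF assms(1), of k "Suc i"]
    by (simp add: add.commute)
  ultimately show ?thesis by (simp add: path_bit_def)
qed

text \<open>A program with this output is counted in the weight of the level-\<open>n\<close> node,
  whose lightness caps even this single contribution.\<close>

lemma path_complexity:
  assumes light: "\<And>k. light (n0 + k) (path q n0 v0 k)"
    and x: "h s x = Suc (str_code (map (path_bit q n0 v0) [0..<m]))" and n: "n0 \<le> n" "n\<^sup>2 \<le> m"
  shows "n\<^sup>2 \<le> code_length x + deficiency n"
proof -
  obtain k where k: "n = n0 + k" using n(1) le_Suc_ex by blast
  let ?v = "path q n0 v0 k" and ?\<sigma> = "map (path_bit q n0 v0) [0..<m]"
  \<comment> \<open>At stage \<open>t\<close> only programs below \<open>t\<close> are counted, so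
    \<open>t\<close> must exceed \<open>x\<close>.\<close>
  define t where "t = max s (Suc x)"
  have ht: "h t x = Suc (str_code ?\<sigma>)" using h_mono[OF x, of t] by (simp add: t_def)
  have path_less: "path q n0 v0 k < 2 ^ (n0 + k)\<^sup>2" for k using light by (auto simp: light_def)
  have "Suc (str_code ?\<sigma>) mod 2 ^ n\<^sup>2 = ?v"
    by (rule str_code_mod) (use n(2) path_less path_bit_iff[OF path_less] in \<open>auto simp: k\<close>)
  moreover have "2 ^ n\<^sup>2 \<le> Suc (str_code ?\<sigma>)"
  proof -
    have "(2::nat) ^ n\<^sup>2 \<le> 2 ^ length ?\<sigma>" using n(2) by (intro power_increasing) auto
    also have "\<dots> \<le> Suc (str_code ?\<sigma>)" using str_code_bounds(1)[of ?\<sigma>] by simp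
    finally show ?thesis .
  qed
  moreover have "x \<in> {..<t}" by (simp add: t_def)
  ultimately have "2 ^ (t - code_length x) \<le> weight t (n\<^sup>2) ?v"
    unfolding weight_def using member_le_sum[of x "{..<t}"
      "\<lambda>x. if 2 ^ n\<^sup>2 \<le> h t x \<and> h t x mod 2 ^ n\<^sup>2 = ?v then (2::nat) ^ (t - code_length x) else 0"] ht
    by simp
  then have "2 ^ n\<^sup>2 * 2 ^ (t - code_length x) \<le> 2 ^ n\<^sup>2 * weight t (n\<^sup>2) ?v" by simp
  also have "\<dots> \<le> 2 ^ (t + deficiency n)"
    using light[of k] by (auto simp: light_def heavy_def k not_less)
  finally have "(2::nat) ^ (n\<^sup>2 + (t - code_length x)) \<le> 2 ^ (t + deficiency n)" by (simp add: power_add)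
  then have "n\<^sup>2 + (t - code_length x) \<le> t + deficiency n" by (simp add: power_increasing_iff)
  moreover have "code_length x \<le> t" using code_length_le[of x] by (simp add: t_def)
  ultimately show ?thesis by linarith
qed

end

section \<open>Prefix-free complexity\<close>

lemma sum_code_length_le:
  assumes h: "\<And>x y. f x = Some y \<longleftrightarrow> (\<exists>s. h s x = Suc y)"
    and f: "\<And>\<sigma>. f (str_code \<sigma>) = map_option str_code (U \<sigma>)"
    and U: "\<forall>\<sigma>\<in>dom U. \<forall>\<tau>\<in>dom U. prefix \<sigma> \<tau> \<longrightarrow> \<sigma> = \<tau>"
  shows "(\<Sum>x<s. if h s x \<noteq> 0 then 2 ^ (s - code_length x) else 0) \<le> (2::nat) ^ s"
proof -
  define B where "B = {x. x < s \<and> h s x \<noteq> 0}"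
  define F where "F = str_code -` B"
  have inj: "inj str_code" by (auto intro: injI inj_str_code)
  have "surj str_code" unfolding surj_def using surj_str_code by metis
  then have image: "str_code ` F = B" unfolding F_def by (rule surj_image_vimage_eq)
  have "finite F" unfolding F_def by (rule finite_vimageI[OF _ inj]) (simp add: B_def)
  have "(\<Sum>x<s. if h s x \<noteq> 0 then 2 ^ (s - code_length x) else 0) = (\<Sum>x\<in>B. (2::nat) ^ (s - code_length x))"
    unfolding B_def by (rule sum.mono_neutral_cong_right) auto
  also have "\<dots> = (\<Sum>\<sigma>\<in>F. 2 ^ (s - length \<sigma>))"
    unfolding image[symmetric] by (subst sum.reindex) (use inj in \<open>auto simp: inj_def inj_on_def\<close>)
  also have "\<dots> \<le> 2 ^ s"
  proof (rule kraft[OF \<open>finite F\<close>])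
    have dom: "\<sigma> \<in> dom U" if "\<sigma> \<in> F" for \<sigma>
    proof -
      from that obtain y where "h s (str_code \<sigma>) = Suc y" by (auto simp: F_def B_def gr0_conv_Suc)
      then have "f (str_code \<sigma>) = Some y" using h by blast
      then show ?thesis using f[of \<sigma>] by auto
    qed
    show "\<sigma> = \<tau>" if "\<sigma> \<in> F" "\<tau> \<in> F" "prefix \<sigma> \<tau>" for \<sigma> \<tau> using U dom that by blast
    show "length \<sigma> \<le> s" if "\<sigma> \<in> F" for \<sigma>
      using that code_length_le[of "str_code \<sigma>"] by (auto simp: F_def B_def)
  qed
  finally show ?thesis .
qed

text \<open>\<open>U\<close> simulates the machine defined on the empty string alone, with value
  \<sigma>. Hence the \<open>LEAST\<close> in \<open>KP\<close> always has a witness.\<close>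

lemma universal_machine_surj:
  assumes "universal_machine U"
  shows "\<exists>\<tau>. U \<tau> = Some \<sigma>"
proof -
  let ?M = "[[] \<mapsto> \<sigma>] :: bool list \<rightharpoonup> bool list"
  have "partial_recursive (\<lambda>x. if \<exists>p::nat. x = 0 then Some (str_code \<sigma>) else None)"
    by (rule partial_recursive_search) (intro rec_intros; simp)+
  moreover have "(\<lambda>x. if \<exists>p::nat. x = 0 then Some (str_code \<sigma>) else None) (str_code \<rho>) =
      map_option str_code (?M \<rho>)" for \<rho>
    by (cases \<rho>) auto
  ultimately have "prefix_free_machine ?M"
    unfolding prefix_free_machine_def by (intro conjI exI[of _ "\<lambda>x. if \<exists>p::nat. x = 0 then Some (str_code \<sigma>) else None"]) auto
  then obtain \<rho> where "\<forall>\<tau>. U (\<rho> @ \<tau>) = ?M \<tau>" using assms unfolding universal_machine_def by blast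
  then have "U (\<rho> @ []) = ?M []" by (rule spec)
  then have "U \<rho> = Some \<sigma>" by simp
  then show ?thesis by blast
qed

lemma KP_witness:
  assumes "universal_machine U"
  shows "\<exists>\<tau>. length \<tau> = KP U \<sigma> \<and> U \<tau> = Some \<sigma>"
proof -
  have "\<exists>k \<tau>. length \<tau> = k \<and> U \<tau> = Some \<sigma>" using universal_machine_surj[OF assms, of \<sigma>] by blast
  then show ?thesis unfolding KP_def by (rule LeastI_ex)
qed

section \<open>The growth rates\<close>

lemma order_function_eventually_ge:
  assumes "order_function f"
  shows "\<forall>\<^sub>F n in sequentially. B \<le> f n"
proof -
  have "mono f" "\<not> bdd_above (range f)" using assms by (auto simp: order_function_def)
  then obtain n0 where "B < f n0" unfolding bdd_above_def by (auto simp: not_le)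
  then have "B \<le> f n" if "n0 \<le> n" for n using monoD[OF \<open>mono f\<close> that] by simp
  then show ?thesis unfolding eventually_sequentially by blast
qed

lemma eventually_squares:
  assumes "\<forall>\<^sub>F n in sequentially. P n"
  shows "\<forall>\<^sub>F n in sequentially. P (n\<^sup>2)" "\<forall>\<^sub>F n in sequentially. P ((n + 1)\<^sup>2)"
proof -
  obtain n0 where n0: "\<And>n. n0 \<le> n \<Longrightarrow> P n" using assms unfolding eventually_sequentially by blast
  have "n \<le> n\<^sup>2" "n \<le> (n + 1)\<^sup>2" for n :: nat by (simp_all add: power2_eq_square)
  then show "\<forall>\<^sub>F n in sequentially. P (n\<^sup>2)" "\<forall>\<^sub>F n in sequentially. P ((n + 1)\<^sup>2)"
    unfolding eventually_sequentially using n0 by (meson le_trans)+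
qed

section \<open>The increments of \<open>n * \<Delta> (n\<^sup>2)\<close> and the size of
  \<open>ell\<close>\<close>

definition increment :: "(nat \<Rightarrow> real) \<Rightarrow> nat \<Rightarrow> real" where
  "increment \<Delta> n = (real n + 1) * \<Delta> ((n + 1)\<^sup>2) - real n * \<Delta> (n\<^sup>2)"

lemma ell_increment: "ell \<epsilon> \<Delta> n = 2 powr ((1 - \<epsilon>) * increment \<Delta> n)"
  by (simp add: ell_def increment_def)

lemma increment_ge:
  assumes "mono \<Delta>"
  shows "\<Delta> ((n + 1)\<^sup>2) \<le> increment \<Delta> n"
proof -
  have "\<Delta> (n\<^sup>2) \<le> \<Delta> ((n + 1)\<^sup>2)" by (intro monoD[OF assms] power_mono) auto
  then have "real n * \<Delta> (n\<^sup>2) \<le> real n * \<Delta> ((n + 1)\<^sup>2)" by (rule mult_left_mono) simp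
  then show ?thesis by (simp add: increment_def algebra_simps)
qed

lemma sum_increment: "(\<Sum>i<n. increment \<Delta> i) = real n * \<Delta> (n\<^sup>2)"
  by (induction n) (simp_all add: increment_def add.commute)

lemma ell_ge:
  assumes "mono \<Delta>" "\<epsilon> < 1"
  shows "2 powr ((1 - \<epsilon>) * \<Delta> ((n + 1)\<^sup>2)) \<le> ell \<epsilon> \<Delta> n"
  unfolding ell_increment using assms increment_ge[OF assms(1), of n]
  by (intro powr_mono mult_left_mono) auto

lemma eventually_ell_ge:
  assumes "order_function \<Delta>" "\<epsilon> < 1"
  shows "\<forall>\<^sub>F n in sequentially. B \<le> ell \<epsilon> \<Delta> n"
proof -
  have mono: "mono \<Delta>" using assms(1) by (simp add: order_function_def)
  define C where "C = log 2 (max B 1) / (1 - \<epsilon>)"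
  have "\<forall>\<^sub>F n in sequentially. C \<le> \<Delta> ((n + 1)\<^sup>2)"
    using eventually_squares(2)[OF order_function_eventually_ge[OF assms(1)]] .
  then show ?thesis
  proof (rule eventually_mono)
    fix n assume "C \<le> \<Delta> ((n + 1)\<^sup>2)"
    then have "log 2 (max B 1) \<le> (1 - \<epsilon>) * \<Delta> ((n + 1)\<^sup>2)"
      using assms(2) by (simp add: C_def field_simps)
    then have "2 powr log 2 (max B 1) \<le> 2 powr ((1 - \<epsilon>) * \<Delta> ((n + 1)\<^sup>2))" by (intro powr_mono) auto
    also have "\<dots> \<le> ell \<epsilon> \<Delta> n" by (rule ell_ge[OF mono assms(2)])
    finally show "B \<le> ell \<epsilon> \<Delta> n" by simp
  qed
qed

lemma eventually_small:
  fixes \<Delta> :: "nat \<Rightarrow> real"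
  assumes "(\<lambda>n. \<Delta> n / sqrt (real n)) \<longlonglongrightarrow> 0"
  shows "\<forall>\<^sub>F n in sequentially. \<Delta> ((n + 1)\<^sup>2) \<le> (real n + 1) / 2"
proof -
  have "\<forall>\<^sub>F n in sequentially. \<Delta> n / sqrt (real n) < 1 / 2"
    using assms by (rule order_tendstoD) simp
  from eventually_squares(2)[OF this] show ?thesis
  proof (rule eventually_mono)
    fix n assume "\<Delta> ((n + 1)\<^sup>2) / sqrt (real ((n + 1)\<^sup>2)) < 1 / 2"
    then show "\<Delta> ((n + 1)\<^sup>2) \<le> (real n + 1) / 2"
      by (simp add: real_sqrt_power divide_less_eq add.commute)
  qed
qed

text \<open>The left-hand side bounds the binary length of the queries made at level \<open>n\<close>.\<close>

lemma eventually_query_length: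
  assumes "order_function \<Delta>" "\<epsilon> < 1"
  shows "\<forall>\<^sub>F n in sequentially.
    4 * ((real n)\<^sup>2 + (2 * real n + 1) * (8 * ell \<epsilon> \<Delta> n)) + 6 + real C \<le> (real n + 1)\<^sup>2 / 2 * ell \<epsilon> \<Delta> n"
  \<comment> \<open>The right-hand side is split into two equal parts. With \<open>ell\<close> at
    least 16 one part covers the quadratic term; the other covers the linear and constant terms,
    whose coefficients are collected in \<open>102 + C\<close> with
    \<open>102 = 64 + 38\<close>.\<close>
  using eventually_ell_ge[OF assms, of 16] eventually_ge_at_top[of "4 * (102 + C)"]
proof eventually_elim
  case (elim n)
  define l where "l = ell \<epsilon> \<Delta> n"
  have l: "16 \<le> l" using elim by (simp add: l_def)
  have "4 * (real n)\<^sup>2 \<le> (real n + 1)\<^sup>2 / 4 * 16" by (simp add: power2_eq_square algebra_simps)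
  also have "\<dots> \<le> (real n + 1)\<^sup>2 / 4 * l" using l by (intro mult_left_mono) auto
  finally have 1: "4 * (real n)\<^sup>2 \<le> (real n + 1)\<^sup>2 / 4 * l" .
  have "(6 + real C) * 1 \<le> (6 + real C) * l" using l by (intro mult_left_mono) auto
  then have "32 * (2 * real n + 1) * l + 6 + C \<le> (64 * real n + 38 + C) * l"
    by (simp add: algebra_simps)
  also have "\<dots> \<le> ((102 + real C) * (real n + 1)) * l"
  proof (rule mult_right_mono)
    have "0 \<le> (38 + real C) * real n" by simp
    moreover have "(102 + real C) * (real n + 1) = 64 * real n + 38 + real C + ((38 + real C) * real n + 64)"
      by (simp add: algebra_simps)
    ultimately show "64 * real n + 38 + real C \<le> (102 + real C) * (real n + 1)" by linarith
  qed (use l in simp)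
  also have "\<dots> \<le> ((real n + 1) / 4 * (real n + 1)) * l"
  proof -
    have "4 * (102 + real C) \<le> real n" using of_nat_mono[OF elim(2), where 'a = real] by simp
    then show ?thesis using l by (intro mult_right_mono) auto
  qed
  finally have "32 * (2 * real n + 1) * l + 6 + C \<le> (real n + 1)\<^sup>2 / 4 * l"
    by (simp add: power2_eq_square)
  with 1 have "4 * (real n)\<^sup>2 + (32 * (2 * real n + 1) * l + 6 + C) \<le> (real n + 1)\<^sup>2 / 2 * l"
    by (simp add: field_simps)
  then show ?case by (simp add: l_def algebra_simps)
qed

text \<open>Exact rounding of a computable real is not effective, so \<open>d\<close> is read off
  from a rational approximation with error at most 1; this is where the slack 3 comes from.
  Rationality of \<epsilon> puts \<open>1 - \<epsilon> = p / r\<close> at the program's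
  disposal.\<close>

lemma computable_increment_bound:
  assumes \<Delta>: "computable_reals \<Delta>" "mono \<Delta>" "\<forall>n. 0 \<le> \<Delta> n"
    and \<epsilon>: "\<epsilon> \<in> \<rat>" "0 < \<epsilon>" "\<epsilon> < 1"
  obtains d where "\<And>A. recursive_in A 1 (\<lambda>xs. d (xs ! 0))" "\<And>n. 0 < d n"
    "\<And>n. (1 - \<epsilon>) * increment \<Delta> n \<le> real (d n)" "\<And>n. real (d n) \<le> (1 - \<epsilon>) * increment \<Delta> n + 3"
proof -
  have "1 - \<epsilon> \<in> \<rat>" using \<epsilon>(1) by simp
  then obtain p r :: nat where pr: "r \<noteq> 0" "\<bar>1 - \<epsilon>\<bar> = real p / real r"
    by (rule Rats_abs_nat_div_natE)
  then have \<epsilon>_eq: "1 - \<epsilon> = real p / real r" using \<epsilon>(3) by simp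
  from \<Delta>(1) obtain a b c where abc: "recursive2 a" "recursive2 b" "recursive2 c"
    "\<And>n k. \<bar>\<Delta> n - (real (a n k) - real (b n k)) / (real (c n k) + 1)\<bar> \<le> 1 / 2 ^ k"
    unfolding computable_reals_def by blast
  \<comment> \<open>\<open>P\<close> and \<open>Q\<close> are the positive and negative parts over a
    common denominator. Precision \<open>n + 1\<close> keeps the total error
    \<open>(2 * n + 1) / 2 ^ (n + 1)\<close> within 1.\<close>
  define P where "P n = (n + 1) * a ((n + 1)\<^sup>2) (n + 1) * (c (n\<^sup>2) (n + 1) + 1) +
    n * b (n\<^sup>2) (n + 1) * (c ((n + 1)\<^sup>2) (n + 1) + 1)" for n
  define Q where "Q n = (n + 1) * b ((n + 1)\<^sup>2) (n + 1) * (c (n\<^sup>2) (n + 1) + 1) +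
    n * a (n\<^sup>2) (n + 1) * (c ((n + 1)\<^sup>2) (n + 1) + 1)" for n
  define R where "R n = r * ((c (n\<^sup>2) (n + 1) + 1) * (c ((n + 1)\<^sup>2) (n + 1) + 1))" for n
  \<comment> \<open>Truncation in \<open>P n - Q n\<close> is harmless because the increment is
    nonnegative. The 2 makes up for the error 1 and the rounding down, and keeps \<open>d n\<close>
    positive.\<close>
  define d where "d n = p * (P n - Q n) div R n + 2" for n
  note abc_intros = abc(1-3)[THEN recursive2_recursive_in, THEN recursive_in_compose2]
  show ?thesis
  proof (rule that[of d])
    show "recursive_in A 1 (\<lambda>xs. d (xs ! 0))" for A
      unfolding d_def P_def Q_def R_def by (intro rec_intros abc_intros; simp)
    show "0 < d n" for n by (simp add: d_def)
    fix n
    define x where "x = real p * (real (P n) - real (Q n)) / real (R n)"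
    have R: "0 < R n" using pr(1) by (simp add: R_def)
    let ?u = "(real (a ((n + 1)\<^sup>2) (n + 1)) - real (b ((n + 1)\<^sup>2) (n + 1))) / (real (c ((n + 1)\<^sup>2) (n + 1)) + 1)"
    let ?v = "(real (a (n\<^sup>2) (n + 1)) - real (b (n\<^sup>2) (n + 1))) / (real (c (n\<^sup>2) (n + 1)) + 1)"
    have frac: "p' * ((N * a1 * C2 + n' * b2 * C1) - (N * b1 * C2 + n' * a2 * C1)) / (r' * (C2 * C1)) =
       p' / r' * (N * ((a1 - b1) / C1) - n' * ((a2 - b2) / C2))"
      if "C1 > 0" "C2 > 0" "r' > 0" for p' r' N n' a1 a2 b1 b2 C1 C2 :: real
      using that by (simp add: divide_simps) (simp add: algebra_simps)
    have x_eq: "x = (1 - \<epsilon>) * ((real n + 1) * ?u - real n * ?v)"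
      unfolding x_def P_def Q_def R_def \<epsilon>_eq of_nat_mult of_nat_add of_nat_1
      by (rule frac) (use pr in auto)
    have scale: "\<bar>t * u - t * w\<bar> \<le> t * e" if "\<bar>u - w\<bar> \<le> e" "0 \<le> t" for t u w e :: real
      using mult_left_mono[OF that] that(2) by (metis abs_mult abs_of_nonneg right_diff_distrib)
    have "\<bar>(real n + 1) * \<Delta> ((n + 1)\<^sup>2) - (real n + 1) * ?u\<bar> \<le> (real n + 1) * (1 / 2 ^ (n + 1))"
      by (rule scale[OF abc(4)]) simp
    moreover have "\<bar>real n * \<Delta> (n\<^sup>2) - real n * ?v\<bar> \<le> real n * (1 / 2 ^ (n + 1))"
      by (rule scale[OF abc(4)]) simp
    moreover have "(real n + 1) * (1 / 2 ^ (n + 1)) + real n * (1 / 2 ^ (n + 1)) \<le> 1"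
    proof -
      have "Suc n \<le> 2 ^ n" by (simp add: Suc_le_eq)
      then have "2 * n + 1 \<le> 2 ^ (n + 1)" by simp
      then have "real (2 * n + 1) \<le> real (2 ^ (n + 1))" by (rule of_nat_mono)
      then show ?thesis by (simp add: field_simps)
    qed
    ultimately have "\<bar>increment \<Delta> n - ((real n + 1) * ?u - real n * ?v)\<bar> \<le> 1"
      unfolding increment_def by linarith
    then have "(1 - \<epsilon>) * \<bar>increment \<Delta> n - ((real n + 1) * ?u - real n * ?v)\<bar> \<le> 1 * 1"
      using \<epsilon> by (intro mult_mono) auto
    then have x: "\<bar>(1 - \<epsilon>) * increment \<Delta> n - x\<bar> \<le> 1"
      unfolding x_eq using \<epsilon>(3) by (simp add: abs_mult flip: right_diff_distrib)
    have nonneg: "0 \<le> (1 - \<epsilon>) * increment \<Delta> n"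
      using \<epsilon>(3) \<Delta>(3) increment_ge[OF \<Delta>(2), of n] by (meson diff_ge_0_iff_ge less_imp_le mult_nonneg_nonneg order_trans)
    define y where "y = real (p * (P n - Q n)) / real (R n)"
    have "y = max 0 x"
    proof (cases "Q n \<le> P n")
      case True
      then have "y = x" by (simp add: x_def y_def of_nat_diff)
      moreover have "0 \<le> x" unfolding x_def using True by (intro divide_nonneg_nonneg mult_nonneg_nonneg) auto
      ultimately show ?thesis by simp
    next
      case False
      then have "x \<le> 0" unfolding x_def
        by (intro divide_nonpos_nonneg mult_nonneg_nonpos) auto
      then show ?thesis using False by (simp add: y_def)
    qed
    moreover have "real (p * (P n - Q n) div R n) \<le> y" "y < real (p * (P n - Q n) div R n) + 1"
    proof -
      have "p * (P n - Q n) < Suc (p * (P n - Q n) div R n) * R n"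
        using R by (metis dividend_less_times_div mult.commute mult_Suc)
      then have "real (p * (P n - Q n)) < real (Suc (p * (P n - Q n) div R n) * R n)" by (rule of_nat_less_iff[THEN iffD2])
      then show "y < real (p * (P n - Q n) div R n) + 1" using R unfolding y_def
        by (simp only: of_nat_mult of_nat_Suc) (simp add: field_simps)
      show "real (p * (P n - Q n) div R n) \<le> y" unfolding y_def by (rule of_nat_div_le_of_nat)
    qed
    ultimately show "(1 - \<epsilon>) * increment \<Delta> n \<le> real (d n)" "real (d n) \<le> (1 - \<epsilon>) * increment \<Delta> n + 3"
      using x nonneg unfolding d_def by auto
  qed
qed

section \<open>The reduction\<close>

text \<open>\<open>v\<close> and \<open>T\<close> have at most \<open>m\<close> bits, and two
  pairings give \<open>2 * (2 * m + 2) + 2 = 4 * m + 6\<close>. The affine translation costs only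
  \<open>a + b\<close> further bits.\<close>

lemma query_le:
  fixes a b :: nat
  assumes "v < 2 ^ n\<^sup>2" "T < (2 ^ (2 * n + 1)) ^ e"
  shows "a * pair n (pair v T) + b \<le> 2 ^ (4 * (n\<^sup>2 + (2 * n + 1) * e) + 6 + (a + b))"
proof -
  define m where "m = n\<^sup>2 + (2 * n + 1) * e"
  have "v < 2 ^ m" using assms(1) by (rule less_le_trans) (simp add: m_def)
  moreover have "T < 2 ^ m"
    using assms(2) unfolding power_mult[symmetric] by (rule less_le_trans) (simp add: m_def)
  ultimately have "pair v T < 2 ^ (2 * m + 2)" by (rule pair_less)
  moreover have "n < 2 ^ (2 * m + 2)"
  proof -
    have "n < 2 ^ n" by simp
    also have "(2::nat) ^ n \<le> 2 ^ (2 * m + 2)"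
    proof (rule power_increasing)
      have "n \<le> n\<^sup>2" by (simp add: power2_eq_square)
      also have "\<dots> \<le> m" by (simp add: m_def)
      finally show "n \<le> 2 * m + 2" by simp
    qed simp
    finally show ?thesis .
  qed
  ultimately have "pair n (pair v T) < 2 ^ (2 * (2 * m + 2) + 2)" by (rule pair_less[rotated])
  moreover have "2 * (2 * m + 2) + 2 = 4 * m + 6" by simp
  ultimately have x: "pair n (pair v T) \<le> 2 ^ (4 * m + 6)" by (simp only: less_imp_le)
  have "a * pair n (pair v T) + b \<le> a * 2 ^ (4 * m + 6) + b * 2 ^ (4 * m + 6)"
    using x by (intro add_mono mult_left_mono) auto
  also have "\<dots> = (a + b) * 2 ^ (4 * m + 6)" by (simp add: algebra_simps)
  also have "\<dots> \<le> 2 ^ (a + b) * 2 ^ (4 * m + 6)"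
    by (intro mult_right_mono less_imp_le) simp_all
  finally show ?thesis by (simp add: m_def power_add mult_ac)
qed

text \<open>Rounding loses \<open>3 * n\<close> and passing from \<open>m\<close> to the square
  below it at most \<open>2 * n\<close>; both are absorbed by
  \<open>\<epsilon> * n * \<Delta> (n\<^sup>2)\<close> once \<Delta> has reached
  \<open>5 / \<epsilon>\<close>. The square \<open>N\<^sup>2\<close> is the additive constant that
  settles short prefixes.\<close>

lemma COMPLEX_I:
  fixes X :: "nat \<Rightarrow> bool"
  assumes mono: "mono \<Delta>" and nonneg: "\<forall>n. 0 \<le> \<Delta> n" and \<epsilon>: "0 < \<epsilon>"
    and unbounded: "\<forall>\<^sub>F n in sequentially. 5 / \<epsilon> \<le> \<Delta> n"
    and K: "\<And>n m. n0 \<le> n \<Longrightarrow> n\<^sup>2 \<le> m \<Longrightarrow>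
      (real n)\<^sup>2 - (1 - \<epsilon>) * (real n * \<Delta> (n\<^sup>2)) - 3 * real n \<le> real (KP U (map X [0..<m]))"
  shows "(\<lambda>n. of_bool (X n)) \<in> COMPLEX U (\<lambda>n. real n - sqrt (real n) * \<Delta> n)"
proof -
  obtain n1 where n1: "\<And>n. n1 \<le> n \<Longrightarrow> 5 / \<epsilon> \<le> \<Delta> (n\<^sup>2)"
    using eventually_squares(1)[OF unbounded] unfolding eventually_sequentially by blast
  define N where "N = max n0 n1"
  have "real m - sqrt (real m) * \<Delta> m - real (N\<^sup>2) \<le> real (KP U (map X [0..<m]))" for m
  proof (cases "m < N\<^sup>2")
    case True
    then have "real m - sqrt (real m) * \<Delta> m - real (N\<^sup>2) \<le> 0"
      using nonneg by (smt (verit) of_nat_less_iff mult_nonneg_nonneg real_sqrt_ge_zero of_nat_0_le_iff)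
    then show ?thesis by (rule order_trans) simp
  next
    case False
    define n where "n = floor_sqrt m"
    have "n\<^sup>2 \<le> m" "m < (Suc n)\<^sup>2" by (simp_all add: n_def Suc_floor_sqrt_power2_gt)
    then have "\<not> (Suc n)\<^sup>2 \<le> N\<^sup>2" using False by linarith
    then have "N \<le> n" by (meson not_less_eq_eq power_mono zero_le)
    have "real n \<le> sqrt (real m)"
      using \<open>n\<^sup>2 \<le> m\<close> by (intro real_le_rsqrt) (metis of_nat_le_iff of_nat_power)
    then have "real n * \<Delta> (n\<^sup>2) \<le> sqrt (real m) * \<Delta> m"
      using nonneg monoD[OF mono \<open>n\<^sup>2 \<le> m\<close>] by (intro mult_mono) auto
    moreover have "real m \<le> (real n)\<^sup>2 + 2 * real n"
    proof -
      have "m \<le> n\<^sup>2 + 2 * n" using \<open>m < (Suc n)\<^sup>2\<close> by (simp add: power2_eq_square)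
      then have "real m \<le> real (n\<^sup>2 + 2 * n)" by (rule of_nat_mono)
      then show ?thesis by simp
    qed
    moreover have "5 * real n \<le> \<epsilon> * (real n * \<Delta> (n\<^sup>2))"
    proof -
      have "5 \<le> \<epsilon> * \<Delta> (n\<^sup>2)" using n1[of n] \<open>N \<le> n\<close> \<epsilon> by (simp add: N_def divide_le_eq mult.commute)
      then have "5 * real n \<le> (\<epsilon> * \<Delta> (n\<^sup>2)) * real n" by (rule mult_right_mono) simp
      then show ?thesis by (simp add: mult_ac)
    qed
    moreover have "(real n)\<^sup>2 - (1 - \<epsilon>) * (real n * \<Delta> (n\<^sup>2)) - 3 * real n \<le> real (KP U (map X [0..<m]))"
      using \<open>N \<le> n\<close> \<open>n\<^sup>2 \<le> m\<close> by (intro K) (simp_all add: N_def)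
    moreover have "0 \<le> real (N\<^sup>2)" by simp
    ultimately show ?thesis by (simp only: left_diff_distrib mult_1)
  qed
  then show ?thesis unfolding COMPLEX_def by blast
qed

text \<open>The common core of both claims. The assumption \<open>bound\<close> is for every
  \<open>C\<close> because the constant \<open>a + b\<close> is known only once
  \<open>first_heavy\<close> has been translated into \<psi>.\<close>

lemma COMPLEX_computable:
  assumes U: "universal_machine U" and \<Delta>: "order_function \<Delta>" "\<forall>n. 0 \<le> \<Delta> n"
    and \<epsilon>: "\<epsilon> \<in> \<rat>" "0 < \<epsilon>" "\<epsilon> < 1"
    and \<psi>: "linearly_universal \<psi>" "\<forall>n. \<psi> n \<noteq> Some (Y n)"
    and bound: "\<And>C. \<forall>\<^sub>F n in sequentially. \<forall>z.
      real z \<le> 2 powr (4 * ((real n)\<^sup>2 + (2 * real n + 1) * (8 * ell \<epsilon> \<Delta> n)) + 6 + real C) \<longrightarrow>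
      real (Y z) < ell \<epsilon> \<Delta> n"
  shows "\<exists>X\<in>COMPLEX U (\<lambda>n. real n - sqrt (real n) * \<Delta> n). turing_computes Y X"
proof -
  have mono: "mono \<Delta>" and comp: "computable_reals \<Delta>" using \<Delta>(1) by (auto simp: order_function_def)
  obtain d where d: "\<And>A. recursive_in A 1 (\<lambda>xs. d (xs ! 0))" "\<And>n. 0 < d n"
    "\<And>n. (1 - \<epsilon>) * increment \<Delta> n \<le> real (d n)" "\<And>n. real (d n) \<le> (1 - \<epsilon>) * increment \<Delta> n + 3"
    using computable_increment_bound[OF comp mono \<Delta>(2) \<epsilon>] by blast
  have ell_le: "ell \<epsilon> \<Delta> n \<le> 2 ^ d n" for n
  proof -
    have "ell \<epsilon> \<Delta> n \<le> 2 powr real (d n)" unfolding ell_increment using d(3) by (intro powr_mono) auto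
    then show ?thesis by (simp add: powr_realpow)
  qed
  have le_ell: "2 ^ d n \<le> 8 * ell \<epsilon> \<Delta> n" for n
  proof -
    have "2 powr real (d n) \<le> 2 powr (3 + (1 - \<epsilon>) * increment \<Delta> n)"
      using d(4)[of n] by (intro powr_mono) auto
    also have "\<dots> = 8 * ell \<epsilon> \<Delta> n" by (simp add: powr_add ell_increment)
    finally show ?thesis by (simp add: powr_realpow)
  qed
  obtain f where f: "partial_recursive f" "\<And>\<sigma>. f (str_code \<sigma>) = map_option str_code (U \<sigma>)"
    and pf: "\<forall>\<sigma>\<in>dom U. \<forall>\<tau>\<in>dom U. prefix \<sigma> \<tau> \<longrightarrow> \<sigma> = \<tau>"
    using U unfolding universal_machine_def prefix_free_machine_def by blast
  obtain h where h: "\<And>A. recursive_in A 2 (\<lambda>ys. h (ys ! 0) (ys ! 1))"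
    "\<And>s t x y. h s x = Suc y \<Longrightarrow> s \<le> t \<Longrightarrow> h t x = Suc y"
    "\<And>x y. f x = Some y \<longleftrightarrow> (\<exists>s. h s x = Suc y)"
    using partial_recursive_approx[OF f(1)] by blast
  interpret halting_stages h d
    by unfold_locales (fact h(2) sum_code_length_le[OF h(3) f(2) pf] d(2) h(1) d(1))+
  obtain a b where ab: "\<And>x. \<psi> (a * x + b) = first_heavy x"
    using \<psi>(1) partial_recursive_first_heavy unfolding linearly_universal_def by blast
  \<comment> \<open>Reading \<open>Y\<close> at the translated argument turns avoidance of \<psi>
    into avoidance of \<open>first_heavy\<close>.\<close>
  define q where "q x = Y (a * x + b)" for x
  have avoid: "first_heavy x \<noteq> Some (q x)" for x using \<psi>(2) by (metis ab q_def)
  from bound[of "a + b"] obtain n0 where n0: "\<And>n z. n0 \<le> n \<Longrightarrow>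
      real z \<le> 2 powr (4 * ((real n)\<^sup>2 + (2 * real n + 1) * (8 * ell \<epsilon> \<Delta> n)) + 6 + real (a + b)) \<Longrightarrow>
      real (Y z) < ell \<epsilon> \<Delta> n"
    unfolding eventually_sequentially by blast
  have q_less: "q (pair n (pair v T)) < 2 ^ d n"
    if "n0 \<le> n" "v < 2 ^ n\<^sup>2" "T < width n ^ 2 ^ d n" for n v T
  proof -
    let ?z = "a * pair n (pair v T) + b" and ?E = "4 * (n\<^sup>2 + (2 * n + 1) * 2 ^ d n) + 6 + (a + b)"
    have "real ?z \<le> real (2 ^ ?E)" by (intro of_nat_mono query_le that)
    also have "\<dots> = 2 powr real ?E" by (simp add: powr_realpow del: of_nat_add of_nat_mult)
    also have "\<dots> \<le> 2 powr (4 * ((real n)\<^sup>2 + (2 * real n + 1) * (8 * ell \<epsilon> \<Delta> n)) + 6 + real (a + b))"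
    proof (rule powr_mono)
      have "real ?E = 4 * ((real n)\<^sup>2 + (2 * real n + 1) * 2 ^ d n) + 6 + real (a + b)"
        by (simp add: algebra_simps)
      also have "\<dots> \<le> 4 * ((real n)\<^sup>2 + (2 * real n + 1) * (8 * ell \<epsilon> \<Delta> n)) + 6 + real (a + b)"
        by (intro add_right_mono mult_left_mono add_left_mono le_ell) simp_all
      finally show "real ?E \<le> \<dots>" .
    qed simp
    finally have "real (Y ?z) < ell \<epsilon> \<Delta> n" by (rule n0[OF that(1)])
    also have "\<dots> \<le> 2 ^ d n" by (rule ell_le)
    finally have "real (Y ?z) < real (2 ^ d n)" by simp
    then show ?thesis unfolding q_def by (simp only: of_nat_less_iff)
  qed
  obtain v0 where v0: "light n0 v0" using light_exists by blast
  have light: "light (n0 + k) (path q n0 v0 k)" for k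
    using avoid q_less v0 by (rule light_path)
  have "(\<lambda>n. of_bool (path_bit q n0 v0 n)) \<in> COMPLEX U (\<lambda>n. real n - sqrt (real n) * \<Delta> n)"
  proof (rule COMPLEX_I[OF mono \<Delta>(2) \<epsilon>(2) order_function_eventually_ge[OF \<Delta>(1)]])
    fix n m assume nm: "n0 \<le> n" "n\<^sup>2 \<le> m"
    let ?\<sigma> = "map (path_bit q n0 v0) [0..<m]"
    obtain \<tau> where \<tau>: "length \<tau> = KP U ?\<sigma>" "U \<tau> = Some ?\<sigma>" using KP_witness[OF U] by blast
    then have "f (str_code \<tau>) = Some (str_code ?\<sigma>)" by (simp add: f(2))
    then obtain s where "h s (str_code \<tau>) = Suc (str_code ?\<sigma>)" using h(3) by blast
    then have "n\<^sup>2 \<le> code_length (str_code \<tau>) + deficiency n"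
      by (rule path_complexity[OF light _ nm])
    then have "real (n\<^sup>2) \<le> real (KP U ?\<sigma> + deficiency n)" by (intro of_nat_mono) (simp add: \<tau>)
    moreover have "real (deficiency n) \<le> (\<Sum>i<n. (1 - \<epsilon>) * increment \<Delta> i + 3)"
      unfolding deficiency_def of_nat_sum by (intro sum_mono d(4))
    then have "real (deficiency n) \<le> (1 - \<epsilon>) * (real n * \<Delta> (n\<^sup>2)) + 3 * real n"
      by (simp add: sum.distrib sum_increment flip: sum_distrib_left)
    ultimately show "(real n)\<^sup>2 - (1 - \<epsilon>) * (real n * \<Delta> (n\<^sup>2)) - 3 * real n \<le> real (KP U ?\<sigma>)" by simp
  qed
  moreover have "turing_computes Y (\<lambda>n. of_bool (path_bit q n0 v0 n))"
  proof (intro turing_computesI recursive_in_path_bit)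
    fix k f assume "recursive_in (\<lambda>x. Some (Y x)) k f"
    then show "recursive_in (\<lambda>x. Some (Y x)) k (\<lambda>xs. q (f xs))"
      unfolding q_def by (intro recursive_in_oracle_query rec_intros)
  qed
  ultimately show ?thesis by blast
qed

section \<open>Piecewise linear extensions and the final estimates\<close>

lemma plin_ge:
  assumes "mono f" "real n \<le> x"
  shows "f n \<le> plin f x"
proof -
  define m where "m = nat \<lfloor>x\<rfloor>"
  have "n \<le> m" using assms(2) by (simp add: m_def le_nat_floor)
  then have "f n \<le> f m" by (rule monoD[OF assms(1)])
  moreover have "real m \<le> x" using assms(2) by (simp add: m_def)
  then have "0 \<le> (f (m + 1) - f m) * (x - real m)" using monoD[OF assms(1), of m "m + 1"] by simp
  ultimately show ?thesis unfolding plin_def Let_def m_def[symmetric] by linarith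
qed

lemma plin_le:
  assumes "mono f" "0 \<le> x" "x + 1 \<le> real n"
  shows "plin f x \<le> f n"
proof -
  define m where "m = nat \<lfloor>x\<rfloor>"
  have x: "0 \<le> x - real m" "x - real m \<le> 1" using assms(2) by (simp_all add: m_def) linarith
  have "real (m + 1) \<le> real n" using x(1) assms(3) by simp
  then have "m + 1 \<le> n" by (simp only: of_nat_le_iff)
  have "(f (m + 1) - f m) * (x - real m) \<le> (f (m + 1) - f m) * 1"
    using x monoD[OF assms(1), of m "m + 1"] by (intro mult_left_mono) auto
  then have "plin f x \<le> f (m + 1)" unfolding plin_def Let_def m_def[symmetric] by simp
  also have "\<dots> \<le> f n" by (rule monoD[OF assms(1) \<open>m + 1 \<le> n\<close>])
  finally show ?thesis .
qed

text \<open>With \<open>y = x / 2 - 2\<close> the right-hand side is \<open>4 * 2 powr y\<close>,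
  and \<open>ln 2 \<ge> 1 / 2\<close> bounds it below by \<open>4 * (1 + y / 2) = x\<close>.\<close>

lemma le_two_powr_half:
  fixes x :: real
  assumes "4 \<le> x"
  shows "x \<le> 2 powr (x / 2)"
proof -
  define y where "y = x / 2 - 2"
  have "1 / 2 \<le> ln (2::real)" using exp_half_le2 by (subst ln_ge_iff) simp_all
  then have "y * (1 / 2) \<le> y * ln 2" using assms by (intro mult_left_mono) (auto simp: y_def)
  then have "1 + y / 2 \<le> exp (y * ln 2)" using exp_ge_add_one_self[of "y * ln 2"] by linarith
  also have "\<dots> = 2 powr y" by (simp add: powr_def)
  finally have "4 * (1 + y / 2) \<le> 2 powr (2 + y)" by (simp add: powr_add)
  then show ?thesis by (simp add: y_def field_simps)
qed

theorem mainTheorem3: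
  fixes U :: "bool list \<rightharpoonup> bool list" and \<Delta> :: "nat \<Rightarrow> real" and \<epsilon> :: real
  assumes "universal_machine U"
    and "order_function \<Delta>" and "\<forall>n. 0 \<le> \<Delta> n"
    and "(\<lambda>n. \<Delta> n / sqrt (real n)) \<longlonglongrightarrow> 0"
    and "\<epsilon> \<in> \<rat>" and "0 < \<epsilon>" and "\<epsilon> < 1"
  shows "(\<forall>a\<ge>2. (\<forall>n\<ge>a. 1 < 2 powr ((1 - \<epsilon>) * plin \<Delta> (log 2 (log 2 (real n))))) \<longrightarrow>
           COMPLEX U (\<lambda>n. real n - sqrt (real n) * \<Delta> n)
             \<le>\<^sub>w LUA_from a (\<lambda>n. 2 powr ((1 - \<epsilon>) * plin \<Delta> (log 2 (log 2 (real n))))))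
       \<and> (\<forall>q a. order_function q \<longrightarrow> (\<forall>n\<ge>a. 1 < q n) \<longrightarrow>
           (\<forall>\<^sub>F n in sequentially.
              plin q (2 powr (inverse (1 - \<epsilon>) *
                ((real n + 1)\<^sup>2 - (real n + 1) * \<Delta> ((n + 1)\<^sup>2)) * ell \<epsilon> \<Delta> n))
              \<le> ell \<epsilon> \<Delta> n) \<longrightarrow>
           COMPLEX U (\<lambda>n. real n - sqrt (real n) * \<Delta> n) \<le>\<^sub>w LUA_from a q)"
proof -
  have mono: "mono \<Delta>" using assms(2) by (simp add: order_function_def)
  have ell_pos: "0 < ell \<epsilon> \<Delta> n" for n by (simp add: ell_def)
  \<comment> \<open>Below \<open>a\<close> the values of \<open>Y\<close> stay under the constant
    \<open>p a\<close>, which \<open>ell\<close> eventually reaches; only arguments from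
    \<open>a\<close> on need an estimate.\<close>
  have reduction: "COMPLEX U (\<lambda>n. real n - sqrt (real n) * \<Delta> n) \<le>\<^sub>w LUA_from a p"
    if "\<And>C. \<forall>\<^sub>F n in sequentially. \<forall>z\<ge>a.
        real z \<le> 2 powr (4 * ((real n)\<^sup>2 + (2 * real n + 1) * (8 * ell \<epsilon> \<Delta> n)) + 6 + real C) \<longrightarrow>
        p z \<le> ell \<epsilon> \<Delta> n" for a p
    unfolding weakly_reducible_def
  proof
    fix Y assume "Y \<in> LUA_from a p"
    then obtain \<psi> where \<psi>: "linearly_universal \<psi>" "\<forall>n. \<psi> n \<noteq> Some (Y n)"
      and Y: "\<And>z. real (Y z) < (if a \<le> z then p z else p a)"
      unfolding LUA_from_def LUA_def by auto
    show "\<exists>X\<in>COMPLEX U (\<lambda>n. real n - sqrt (real n) * \<Delta> n). turing_computes Y X"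
    proof (rule COMPLEX_computable[OF assms(1-3,5-7) \<psi>])
      fix C
      show "\<forall>\<^sub>F n in sequentially. \<forall>z.
        real z \<le> 2 powr (4 * ((real n)\<^sup>2 + (2 * real n + 1) * (8 * ell \<epsilon> \<Delta> n)) + 6 + real C) \<longrightarrow>
        real (Y z) < ell \<epsilon> \<Delta> n"
        using that[of C] eventually_ell_ge[OF assms(2,7), of "p a"]
      proof eventually_elim
        case (elim n)
        show ?case
        proof (intro allI impI)
          fix z assume z: "real z \<le> 2 powr (4 * ((real n)\<^sup>2 + (2 * real n + 1) * (8 * ell \<epsilon> \<Delta> n)) + 6 + real C)"
          show "real (Y z) < ell \<epsilon> \<Delta> n"
          proof (cases "a \<le> z")
            case True
            then show ?thesis using Y[of z] elim(1) z by (auto intro: less_le_trans)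
          next
            case False
            then show ?thesis using Y[of z] elim(2) by simp
          qed
        qed
      qed
    qed
  qed
  show ?thesis
  proof (intro conjI allI impI)
    fix a :: nat assume a: "2 \<le> a"
    let ?p = "\<lambda>n. 2 powr ((1 - \<epsilon>) * plin \<Delta> (log 2 (log 2 (real n))))"
    show "COMPLEX U (\<lambda>n. real n - sqrt (real n) * \<Delta> n) \<le>\<^sub>w LUA_from a ?p"
    proof (rule reduction)
      fix C
      show "\<forall>\<^sub>F n in sequentially. \<forall>z\<ge>a.
        real z \<le> 2 powr (4 * ((real n)\<^sup>2 + (2 * real n + 1) * (8 * ell \<epsilon> \<Delta> n)) + 6 + real C) \<longrightarrow>
        ?p z \<le> ell \<epsilon> \<Delta> n"
        using eventually_query_length[OF assms(2,7), of C] eventually_small[OF assms(4)]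
          eventually_ge_at_top[of 1]
      proof eventually_elim
        case (elim n)
        define S where "S = (real n + 1)\<^sup>2"
        have S: "4 \<le> S" unfolding S_def using power_mono[of 2 "real n + 1" 2] elim(3) by simp
        have "increment \<Delta> n \<le> (real n + 1) * \<Delta> ((n + 1)\<^sup>2)" using assms(3) by (simp add: increment_def)
        also have "\<dots> \<le> (real n + 1) * ((real n + 1) / 2)" using elim(2) by (intro mult_left_mono) auto
        also have "\<dots> = S / 2" by (simp add: S_def power2_eq_square)
        finally have "increment \<Delta> n \<le> S / 2" .
        moreover have "0 \<le> increment \<Delta> n" using increment_ge[OF mono, of n] assms(3) by (meson order_trans)
        ultimately have "(1 - \<epsilon>) * increment \<Delta> n \<le> 1 * (S / 2)"
          using assms(6,7) by (intro mult_mono) auto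
        then have ell: "ell \<epsilon> \<Delta> n \<le> 2 powr (S / 2)" unfolding ell_increment by (intro powr_mono) auto
        \<comment> \<open>Smallness of \<Delta> leaves half of the exponent \<open>S\<close> to each
          factor. The gain of 1 in \<open>S - 1\<close> pays for the
          \<open>x + 1 \<le> real n\<close> of \<open>plin_le\<close>.\<close>
        have "S / 2 * ell \<epsilon> \<Delta> n \<le> 2 powr (S / 2) / 2 * 2 powr (S / 2)"
          using ell le_two_powr_half[OF S] S ell_pos[of n] by (intro mult_mono) auto
        also have "\<dots> = 2 powr (S - 1)" by (simp add: powr_diff flip: powr_add)
        finally have le: "4 * ((real n)\<^sup>2 + (2 * real n + 1) * (8 * ell \<epsilon> \<Delta> n)) + 6 + real C \<le> 2 powr (S - 1)"
          using elim(1) unfolding S_def by linarith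
        show ?case
        proof (intro allI impI)
          fix z assume z: "a \<le> z"
            "real z \<le> 2 powr (4 * ((real n)\<^sup>2 + (2 * real n + 1) * (8 * ell \<epsilon> \<Delta> n)) + 6 + real C)"
          \<comment> \<open>From 2 on the iterated logarithm is nonnegative, as the piecewise linear
            extension requires.\<close>
          have z2: "2 \<le> real z" using a z(1) by simp
          have "real z \<le> 2 powr (2 powr (S - 1))"
            using z(2) le by (meson order_trans powr_mono one_le_numeral)
          then have "log 2 (real z) \<le> 2 powr (S - 1)" using z2 by (subst log_le_iff) auto
          moreover have "1 \<le> log 2 (real z)" using z2 by (simp add: le_log_iff)
          ultimately have "log 2 (log 2 (real z)) \<le> S - 1" "0 \<le> log 2 (log 2 (real z))"
            by (simp_all add: log_le_iff)
          then have "plin \<Delta> (log 2 (log 2 (real z))) \<le> \<Delta> ((n + 1)\<^sup>2)"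
            by (intro plin_le mono) (simp_all add: S_def add.commute)
          then have "?p z \<le> 2 powr ((1 - \<epsilon>) * \<Delta> ((n + 1)\<^sup>2))"
            using assms(7) by (intro powr_mono mult_left_mono) auto
          also have "\<dots> \<le> ell \<epsilon> \<Delta> n" by (rule ell_ge[OF mono assms(7)])
          finally show "?p z \<le> ell \<epsilon> \<Delta> n" .
        qed
      qed
    qed
  next
    fix q a
    assume q: "order_function q" and le: "\<forall>\<^sub>F n in sequentially.
      plin q (2 powr (inverse (1 - \<epsilon>) * ((real n + 1)\<^sup>2 - (real n + 1) * \<Delta> ((n + 1)\<^sup>2)) * ell \<epsilon> \<Delta> n))
        \<le> ell \<epsilon> \<Delta> n"
    have "mono q" using q by (simp add: order_function_def)
    show "COMPLEX U (\<lambda>n. real n - sqrt (real n) * \<Delta> n) \<le>\<^sub>w LUA_from a q"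
    proof (rule reduction)
      fix C
      show "\<forall>\<^sub>F n in sequentially. \<forall>z\<ge>a.
        real z \<le> 2 powr (4 * ((real n)\<^sup>2 + (2 * real n + 1) * (8 * ell \<epsilon> \<Delta> n)) + 6 + real C) \<longrightarrow>
        q z \<le> ell \<epsilon> \<Delta> n"
        using le eventually_query_length[OF assms(2,7), of C] eventually_small[OF assms(4)]
      proof eventually_elim
        case (elim n)
        let ?k = "(real n + 1)\<^sup>2 - (real n + 1) * \<Delta> ((n + 1)\<^sup>2)"
        \<comment> \<open>Smallness of \<Delta> preserves half of
          \<open>(real n + 1)\<^sup>2\<close>, the amount to which
          \<open>eventually_query_length\<close> is tuned.\<close>
        have "(real n + 1) * \<Delta> ((n + 1)\<^sup>2) \<le> (real n + 1) * ((real n + 1) / 2)"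
          using elim(3) by (intro mult_left_mono) auto
        then have k: "(real n + 1)\<^sup>2 / 2 \<le> ?k" by (simp add: power2_eq_square)
        have "1 * ((real n + 1)\<^sup>2 / 2) \<le> inverse (1 - \<epsilon>) * ?k"
          using k assms(6,7) by (intro mult_mono) (auto simp: one_le_inverse_iff)
        then have "(real n + 1)\<^sup>2 / 2 * ell \<epsilon> \<Delta> n \<le> inverse (1 - \<epsilon>) * ?k * ell \<epsilon> \<Delta> n"
          using ell_pos[of n] by (intro mult_right_mono) auto
        with elim(2) have
          "4 * ((real n)\<^sup>2 + (2 * real n + 1) * (8 * ell \<epsilon> \<Delta> n)) + 6 + real C \<le> inverse (1 - \<epsilon>) * ?k * ell \<epsilon> \<Delta> n"
          by (rule order_trans)
        then have "2 powr (4 * ((real n)\<^sup>2 + (2 * real n + 1) * (8 * ell \<epsilon> \<Delta> n)) + 6 + real C)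
            \<le> 2 powr (inverse (1 - \<epsilon>) * ?k * ell \<epsilon> \<Delta> n)"
          by (rule powr_mono) simp
        then show ?case using plin_ge[OF \<open>mono q\<close>] elim(1) by (meson order_trans)
      qed
    qed
  qed
qed

end
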